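(* Let $\Omega$ be an r.e. infinite set, and let $P\in\mathbb{P}(\Omega)$ be a discrete probability space on $\Omega$. Let $A_1,\dots,A_n\subset\Omega$ be recursive events. Then the following conditions are equivalent to one another. (i) The events $A_1,\dots,A_n$ are independent on $P$. (ii) For every ensemble $\alpha$ for $P$, the ensembles $\mathrm{C}_{A_1}(\alpha),\dots,\mathrm{C}_{A_n}(\alpha)$ are independent. (iii) There exists an ensemble $\alpha$ for $P$ such that the ensembles $\mathrm{C}_{A_1}(\alpha),\dots,\mathrm{C}_{A_n}(\alpha)$ are independent.
   Context: Alphabets and sequences. $\mathbb{N}^+=\{1,2,3,\dots\}$. For a nonempty set $\Omega$ (alphabet), $\Omega^*$ is the set of finite strings over $\Omega$ (including the empty string $\lambda$), and $\Omega^\infty$ is the set of infinite sequences $\alpha=\alpha(1)\alpha(2)\alpha(3)\cdots$ over $\Omega$; $\alpha\upharpoonright_n$ is the string of the first $n$ elements of $\alpha$. A set $S\subset\Omega^*$ is prefix-free if no string in $S$ is a prefix of another string in $S$. For $S\subset\Omega^*$, $[S]^{\prec}=\{\alpha\in\Omega^\infty\mid \exists n\ge 0,\ \alpha\upharpoonright_n\in S\}$. An r.e. infinite set is an infinite recursively enumerable set (of finite objects usable as Turing machine inputs). A recursive event is a subset of $\Omega$ that is a recursive set. Probability spaces. For a countably infinite set $\Omega$, a discrete probability space on $\Omega$ is a function $P\colon\Omega\to\mathbb{R}$ with $P(a)\ge 0$ for all $a$ and $\sum_{a\in\Omega}P(a)=1$ (no computability is assumed); a finite probability space is defined in the same way for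 a nonempty finite $\Omega$. In both cases $\mathbb{P}(\Omega)$ is the set of all such functions. An event is a subset $A\subset\Omega$, and $P(A)=\sum_{a\in A}P(a)$. For $\sigma=\sigma_1\cdots\sigma_n\in\Omega^*$, $P(\sigma)=P(\sigma_1)\cdots P(\sigma_n)$ and $P(\lambda)=1$. The (generalized) Bernoulli measure $\lambda_P$ is the probability measure on the Borel $\sigma$-field of $\Omega^\infty$ (generated by the open sets $[S]^{\prec}$, $S\subset\Omega^*$) determined by $\lambda_P([\{\sigma\}]^{\prec})=P(\sigma)$ for all $\sigma\in\Omega^*$. Ensembles. Let $\Omega$ be an r.e. infinite set or a nonempty finite set, and $P\in\mathbb{P}(\Omega)$. A Martin-Löf $P$-test is an r.e. set $\mathcal{C}\subset\mathbb{N}^+\times\Omega^*$ such that for every $n\in\mathbb{N}^+$ the set $\mathcal{C}_n=\{\sigma\mid(n,\sigma)\in\mathcal{C}\}$ is prefix-free and $\lambda_P([\mathcal{C}_n]^{\prec})<2^{-n}$. A sequence $\alpha\in\Omega^\infty$ is Martin-Löf $P$-random if for every Martin-Löf $P$-test $\mathcal{C}$ there is $n\in\mathbb{N}^+$ with $\alpha\notin[\mathcal{C}_n]^{\prec}$. An ensemble for $P$ is a Martin-Löf $P$-random sequence in $\Omega^\infty$. Events. Events $A_1,\dots,A_n$ are independent on $P$ if $P(A_{i_1}\cap\dots\cap A_{i_k})=P(A_{i_1})\cdots P(A_{i_k})$ for all $1\le i_1<\dots<i_k\le n$. For $A\subset\Omega$ and $\alpha\in\Omega^\infty$, $\mathrm{C}_A(\alpha)\in\{0,1\}^\infty$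 is the binary sequence whose $k$th element is $1$ if $\alpha(k)\in A$ and $0$ otherwise. $C(P,A)\in\mathbb{P}(\{0,1\})$ is the finite probability space with $C(P,A)(1)=P(A)$ and $C(P,A)(0)=1-P(A)$. Independence of ensembles. For $P_i\in\mathbb{P}(\Omega_i)$, $P_1\times\dots\times P_n\in\mathbb{P}(\Omega_1\times\dots\times\Omega_n)$ is given by $(a_1,\dots,a_n)\mapsto P_1(a_1)\cdots P_n(a_n)$. For $\alpha_i\in\Omega_i^\infty$, $\alpha_1\times\dots\times\alpha_n$ is the sequence over $\Omega_1\times\dots\times\Omega_n$ whose $k$th element is $(\alpha_1(k),\dots,\alpha_n(k))$. Ensembles $\alpha_1,\dots,\alpha_n$ for $P_1,\dots,P_n$, respectively, are independent if $\alpha_1\times\dots\times\alpha_n$ is an ensemble for $P_1\times\dots\times P_n$. In the claim, $\mathrm{C}_{A_i}(\alpha)$ is regarded as an ensemble for $C(P,A_i)$ over the alphabet $\{0,1\}$. *)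

theory Defs
  imports "HOL-Probability.Probability" "HOL-Library.Nat_Bijection" "HOL-Library.Sublist"
begin

section \<open>Recursive and recursively enumerable sets\<close>

text \<open>
  Partial recursive functions in the sense of Kleene. The functions take lists of arguments of
  arbitrary length; restricting a term to lists of length \<open>k\<close> gives a partial recursive function
  of \<open>k\<close> arguments, and all of these arise in this way.
\<close>

datatype recf = Zero | Succ | Proj nat | Comp recf "recf list" | PrimRec recf recf | Mu recf

inductive rec_eval :: "recf \<Rightarrow> nat list \<Rightarrow> nat \<Rightarrow> bool" where
  Zero: "rec_eval Zero xs 0"
| Succ: "rec_eval Succ [x] (Suc x)"
| Proj: "i < length xs \<Longrightarrow> rec_eval (Proj i) xs (xs ! i)"
| Comp: "list_all2 (\<lambda>g y. rec_eval g xs y) gs ys \<Longrightarrow> rec_eval f ys z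
    \<Longrightarrow> rec_eval (Comp f gs) xs z"
| PrimRec_0: "rec_eval f xs z \<Longrightarrow> rec_eval (PrimRec f g) (0 # xs) z"
| PrimRec_Suc: "rec_eval (PrimRec f g) (x # xs) y \<Longrightarrow> rec_eval g (x # y # xs) z
    \<Longrightarrow> rec_eval (PrimRec f g) (Suc x # xs) z"
| Mu: "rec_eval f (x # xs) 0 \<Longrightarrow> (\<And>w. w < x \<Longrightarrow> \<exists>y. rec_eval f (w # xs) (Suc y))
    \<Longrightarrow> rec_eval (Mu f) xs x"

inductive_cases rec_eval_cases:
  "rec_eval Zero xs z" "rec_eval Succ xs z" "rec_eval (Proj i) xs z" "rec_eval (Comp f gs) xs z"
  "rec_eval (PrimRec f g) (0 # xs) z" "rec_eval (PrimRec f g) (Suc x # xs) z"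
  "rec_eval (Mu f) xs z"

lemma rec_eval_functional: "rec_eval f xs y \<Longrightarrow> rec_eval f xs z \<Longrightarrow> y = z"
proof (induction arbitrary: z rule: rec_eval.induct)
  case (Comp xs gs ys f v)
  from Comp.prems obtain ys' where ys':
    "list_all2 (\<lambda>g y. rec_eval g xs y) gs ys'" "rec_eval f ys' z"
    by (rule rec_eval_cases)
  have "ys = ys'"
    using Comp.IH(1) ys'(1) by (auto simp: list_all2_conv_all_nth intro!: nth_equalityI)
  with Comp.IH(2) ys'(2) show ?case by blast
next
  case (PrimRec_0 f xs y g)
  from PrimRec_0.prems show ?case by (rule rec_eval_cases) (rule PrimRec_0.IH)
next
  case (PrimRec_Suc f g x xs y v)
  from PrimRec_Suc.prems obtain y' where y':
    "rec_eval (PrimRec f g) (x # xs) y'" "rec_eval g (x # y' # xs) z"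
    by (rule rec_eval_cases)
  with PrimRec_Suc.IH show ?case by blast
next
  case (Mu f x xs)
  from Mu.prems have z: "rec_eval f (z # xs) 0"
    and less: "\<And>w. w < z \<Longrightarrow> \<exists>y. rec_eval f (w # xs) (Suc y)"
    by (auto elim: rec_eval_cases(7))
  show ?case
  proof (rule linorder_cases[of x z])
    assume "x < z"
    then obtain y where "rec_eval f (x # xs) (Suc y)" using less by blast
    then show ?thesis using Mu.IH(1) by blast
  next
    assume "z < x"
    then obtain y where "\<And>v. rec_eval f (z # xs) v \<Longrightarrow> Suc y = v" using Mu.IH(2) by blast
    then show ?thesis using z by blast
  qed
qed (auto elim: rec_eval_cases(1-3))

definition nat_re :: "nat set \<Rightarrow> bool" where
  "nat_re S \<longleftrightarrow> (\<exists>f. S = {x. \<exists>y. rec_eval f [x] y})"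

definition nat_recursive :: "nat set \<Rightarrow> bool" where
  "nat_recursive S \<longleftrightarrow> (\<exists>f. \<forall>x. rec_eval f [x] (if x \<in> S then 1 else 0))"

text \<open>
  Types of finite objects, equipped with a coding of their elements by natural numbers.
\<close>

class coded =
  fixes code :: "'a \<Rightarrow> nat"
  assumes inj_code: "inj code"

instantiation nat :: coded
begin
definition code_nat :: "nat \<Rightarrow> nat" where "code_nat n = n"
instance by standard (simp add: code_nat_def inj_def)
end

instantiation prod :: (coded, coded) coded
begin
definition code_prod :: "'a \<times> 'b \<Rightarrow> nat" where
  "code_prod p = prod_encode (code (fst p), code (snd p))"
instance
  by standard (auto simp: code_prod_def inj_def prod_eq_iff dest: injD[OF inj_code])
end

instantiation list :: (coded) coded
begin
definition code_list :: "'a list \<Rightarrow> nat" where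
  "code_list xs = list_encode (map code xs)"
instance
  by standard (auto simp: code_list_def inj_def list_encode_eq inj_map_eq_map[OF inj_code])
end

definition recursively_enumerable :: "'a::coded set \<Rightarrow> bool" where
  "recursively_enumerable S \<longleftrightarrow> nat_re (code ` S)"

definition recursive :: "'a::coded set \<Rightarrow> bool" where
  "recursive S \<longleftrightarrow> nat_recursive (code ` S)"


section \<open>Bernoulli measures\<close>

text \<open>
  A probability space on \<open>\<Omega>\<close> is extended by zero to the whole type.
\<close>

definition prob_spaces :: "'a set \<Rightarrow> 'a pmf set" where
  "prob_spaces \<Omega> = {P. set_pmf P \<subseteq> \<Omega>}"

definition prefix_free :: "'a list set \<Rightarrow> bool" where
  "prefix_free S \<longleftrightarrow> (\<forall>\<sigma>\<in>S. \<forall>\<tau>\<in>S. prefix \<sigma> \<tau> \<longrightarrow> \<sigma> = \<tau>)"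

definition cylinder :: "'a set \<Rightarrow> 'a list set \<Rightarrow> 'a stream set" where
  "cylinder \<Omega> S = {\<alpha> \<in> streams \<Omega>. \<exists>n. stake n \<alpha> \<in> S}"

text \<open>
  This is a measure on all streams over the type; for \<open>P \<in> prob_spaces \<Omega>\<close> it is concentrated on
  \<^term>\<open>streams \<Omega>\<close>.
\<close>

definition bernoulli :: "'a pmf \<Rightarrow> 'a stream measure" where
  "bernoulli P = stream_space (measure_pmf P)"

lemma sets_bernoulli: "sets (bernoulli P) = sets (stream_space (count_space UNIV))"
  unfolding bernoulli_def by (intro sets_stream_space_cong) simp

lemma prob_space_bernoulli: "prob_space (bernoulli P)"
  unfolding bernoulli_def by (rule prob_space.prob_space_stream_space[OF prob_space_measure_pmf])

lemma cylinder_singleton: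
  assumes "\<sigma> \<in> lists \<Omega>"
  shows "cylinder \<Omega> {\<sigma>} = sstart \<Omega> \<sigma>"
proof -
  have "\<alpha> \<in> cylinder \<Omega> {\<sigma>} \<longleftrightarrow> \<alpha> \<in> sstart \<Omega> \<sigma>" if "\<alpha> \<in> streams \<Omega>" for \<alpha>
  proof -
    have "(\<exists>n. stake n \<alpha> = \<sigma>) \<longleftrightarrow> stake (length \<sigma>) \<alpha> = \<sigma>"
      by (metis length_stake)
    also have "\<dots> \<longleftrightarrow> (\<forall>i<length \<sigma>. \<alpha> !! i = \<sigma> ! i)"
      by (auto simp: list_eq_iff_nth_eq)
    finally show ?thesis using that by (simp add: cylinder_def sstart_eq)
  qed
  then show ?thesis
    using sstart_in_streams[OF assms] by (auto simp: cylinder_def)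
qed

lemma cylinder_measurable:
  fixes S :: "'a::coded list set"
  shows "cylinder \<Omega> S \<in> sets (bernoulli P)"
proof -
  have "cylinder \<Omega> S = (\<Union>\<sigma>\<in>S \<inter> lists \<Omega>. cylinder \<Omega> {\<sigma>})"
  proof -
    have "stake n \<alpha> \<in> lists \<Omega>" if "\<alpha> \<in> streams \<Omega>" for n \<alpha>
      using that by (auto simp: streams_iff_snth in_set_conv_nth)
    then show ?thesis by (force simp: cylinder_def)
  qed
  also have "\<dots> = (\<Union>\<sigma>\<in>S \<inter> lists \<Omega>. sstart \<Omega> \<sigma>)"
    by (intro SUP_cong refl cylinder_singleton) auto
  also have "\<dots> \<in> sets (bernoulli P)"
    unfolding sets_bernoulli
    by (intro sets.countable_UN'' countableI[OF inj_on_subset[OF inj_code]] sets_sstart) auto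
  finally show ?thesis .
qed

lemma measure_bernoulli_cylinder:
  assumes P: "P \<in> prob_spaces \<Omega>" and \<sigma>: "\<sigma> \<in> lists \<Omega>"
  shows "measure (bernoulli P) (cylinder \<Omega> {\<sigma>}) = (\<Prod>a\<leftarrow>\<sigma>. pmf P a)"
proof -
  have "emeasure (bernoulli P) (sstart \<Omega> \<sigma>) = ennreal (\<Prod>a\<leftarrow>\<sigma>. pmf P a)"
    using \<sigma>
  proof (induction \<sigma>)
    case Nil
    have "AE \<alpha> in bernoulli P. \<alpha> \<in> streams \<Omega>"
    proof -
      have "AE \<alpha> in bernoulli P. \<forall>i. \<alpha> !! i \<in> \<Omega>"
        unfolding bernoulli_def
      proof (rule prob_space.AE_stream_all[OF prob_space_measure_pmf, unfolded stream_all_def])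
        show "AE a in measure_pmf P. a \<in> \<Omega>"
          using P by (auto simp: prob_spaces_def AE_measure_pmf_iff)
      qed simp
      then show ?thesis by (simp add: streams_iff_snth)
    qed
    moreover have "streams \<Omega> \<in> sets (bernoulli P)"
      using streams_sets[of \<Omega> "measure_pmf P"] by (simp add: bernoulli_def)
    ultimately show ?case
      using prob_space.emeasure_eq_1_AE[OF prob_space_bernoulli] by simp
  next
    case (Cons a \<sigma>)
    interpret B: prob_space "bernoulli P" by (rule prob_space_bernoulli)
    have "emeasure (bernoulli P) (sstart \<Omega> (a # \<sigma>)) =
        (\<integral>\<^sup>+t. emeasure (bernoulli P) {\<alpha>. t ## \<alpha> \<in> sstart \<Omega> (a # \<sigma>)} \<partial>measure_pmf P)"
      unfolding bernoulli_def
      by (subst prob_space.emeasure_stream_space[OF prob_space_measure_pmf])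
        (simp_all only: sets_bernoulli[unfolded bernoulli_def] sets_sstart, simp add: space_stream_space)
    also have "\<dots> = (\<integral>\<^sup>+t. emeasure (bernoulli P) (sstart \<Omega> \<sigma>) * indicator {a} t \<partial>measure_pmf P)"
      by (intro nn_integral_cong) (auto simp: indicator_def)
    also have "\<dots> = emeasure (bernoulli P) (sstart \<Omega> \<sigma>) * emeasure (measure_pmf P) {a}"
      by (rule nn_integral_cmult_indicator) simp
    also have "\<dots> = ennreal (\<Prod>a\<leftarrow>a # \<sigma>. pmf P a)"
      using Cons
      by (simp add: emeasure_pmf_single ennreal_mult' mult.commute prod_list_nonneg)
    finally show ?case .
  qed
  moreover have "0 \<le> (\<Prod>a\<leftarrow>\<sigma>. pmf P a)"
    by (induction \<sigma>) auto
  ultimately show ?thesis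
    using cylinder_singleton[OF \<sigma>] by (simp add: measure_def)
qed


section \<open>Randomness and independence of ensembles\<close>

definition martin_loef_test :: "'a::coded set \<Rightarrow> 'a pmf \<Rightarrow> (nat \<times> 'a list) set \<Rightarrow> bool" where
  "martin_loef_test \<Omega> P C \<longleftrightarrow>
     recursively_enumerable C \<and> C \<subseteq> {1..} \<times> lists \<Omega> \<and>
     (\<forall>n\<ge>1. prefix_free (C `` {n}) \<and>
            measure (bernoulli P) (cylinder \<Omega> (C `` {n})) < (1 / 2) ^ n)"

definition ensemble :: "'a::coded set \<Rightarrow> 'a pmf \<Rightarrow> 'a stream \<Rightarrow> bool" where
  "ensemble \<Omega> P \<alpha> \<longleftrightarrow>
     \<alpha> \<in> streams \<Omega> \<and> (\<forall>C. martin_loef_test \<Omega> P C \<longrightarrow> (\<exists>n\<ge>1. \<alpha> \<notin> cylinder \<Omega> (C `` {n})))"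

text \<open>
  A product of \<open>n\<close> alphabets is represented by lists: \<^term>\<open>listset \<Omega>s\<close> consists of the lists whose
  \<open>i\<close>th element is in the \<open>i\<close>th alphabet of \<open>\<Omega>s\<close>.
\<close>

primrec product_pmf :: "'a pmf list \<Rightarrow> 'a list pmf" where
  "product_pmf [] = return_pmf []"
| "product_pmf (P # Ps) = map_pmf (\<lambda>(a, as). a # as) (pair_pmf P (product_pmf Ps))"

lemma pmf_product_pmf:
  "length as = length Ps \<Longrightarrow> pmf (product_pmf Ps) as = (\<Prod>(P, a)\<leftarrow>zip Ps as. pmf P a)"
proof (induction Ps arbitrary: as)
  case (Cons P Ps)
  then obtain a bs where as: "as = a # bs" and len: "length bs = length Ps"
    by (cases as) auto
  have "pmf (product_pmf (P # Ps)) ((\<lambda>(a, as). a # as) (a, bs)) = pmf P a * pmf (product_pmf Ps) bs"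
    unfolding product_pmf.simps by (subst pmf_map_inj') (auto simp: inj_def pmf_pair)
  with Cons.IH[OF len] show ?case by (simp add: as)
qed auto

definition product_stream :: "'a stream list \<Rightarrow> 'a list stream" where
  "product_stream \<alpha>s = to_stream (\<lambda>k. map (\<lambda>\<alpha>. \<alpha> !! k) \<alpha>s)"

definition independent_ensembles ::
    "'a::coded set list \<Rightarrow> 'a pmf list \<Rightarrow> 'a stream list \<Rightarrow> bool" where
  "independent_ensembles \<Omega>s Ps \<alpha>s \<longleftrightarrow>
     ensemble (listset \<Omega>s) (product_pmf Ps) (product_stream \<alpha>s)"

definition event_stream :: "'a set \<Rightarrow> 'a stream \<Rightarrow> nat stream" where
  "event_stream A \<alpha> = smap (\<lambda>a. if a \<in> A then 1 else 0) \<alpha>"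

definition event_pmf :: "'a pmf \<Rightarrow> 'a set \<Rightarrow> nat pmf" where
  "event_pmf P A = map_pmf of_bool (bernoulli_pmf (measure_pmf.prob P A))"

lemma pmf_event_pmf:
  "pmf (event_pmf P A) 1 = measure_pmf.prob P A"
  "pmf (event_pmf P A) 0 = 1 - measure_pmf.prob P A"
proof -
  have inj: "inj (of_bool :: bool \<Rightarrow> nat)" by (auto simp: inj_def)
  show "pmf (event_pmf P A) 1 = measure_pmf.prob P A"
    using pmf_map_inj'[OF inj, of "bernoulli_pmf (measure_pmf.prob P A)" True]
    by (simp add: event_pmf_def)
  show "pmf (event_pmf P A) 0 = 1 - measure_pmf.prob P A"
    using pmf_map_inj'[OF inj, of "bernoulli_pmf (measure_pmf.prob P A)" False]
    by (simp add: event_pmf_def)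
qed

end

theory Submission
  imports Defs
begin

text \<open>
  Write \<open>f a\<close> for the vector of the truth values of \<open>a \<in> A 1, \<dots>, a \<in> A n\<close>. For an ensemble \<open>\<alpha>\<close> for \<open>P\<close>, the
  product of the binary sequences of the events is the image of \<open>\<alpha>\<close> under \<open>f\<close>. So independence of these
  ensembles means that the image is random for the product \<open>Q\<close> of the marginal distributions, whereas
  independence of the events means that \<open>Q\<close> is the distribution \<open>R\<close> of \<open>f\<close> under \<open>P\<close>
  (\<open>indep_events_imp_product_pmf\<close>, \<open>product_pmf_imp_indep_events\<close>). The theorem therefore compares
  \<open>Q\<close> and \<open>R\<close>, and rests on three facts.

  \<^item> The image of an ensemble under a computable map is an ensemble for the image distribution
    (\<open>ensemble_smap\<close>), because tests can be pulled back along the map. So the image of \<open>\<alpha>\<close> is always random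
    for \<open>R\<close>; if \<open>Q = R\<close>, it is random for \<open>Q\<close>.

  \<^item> A sequence is an ensemble for at most one distribution (\<open>ensemble_determines_pmf\<close>). This is a
    consequence of the law of large numbers: the distribution can be read off from the relative
    frequencies. So if the image of a single ensemble \<open>\<alpha>\<close> is random for \<open>Q\<close>, then \<open>Q = R\<close>.

  \<^item> Every probability space has an ensemble (\<open>ensemble_exists\<close>), as only countably many tests exist and
    each of them excludes a null set. So a statement about all ensembles yields one about some ensemble.

  The distribution \<open>P\<close> may be noncomputable. The test that proves the law of large numbers is enumerable
  all the same, because it refers to the probability of an event only through a rational bound and two
  natural numbers that control the speed of convergence.

  The computability theory that is needed is a calculus of closure properties: recursive functions on
  numbers are lifted to functions between coded types, decidable predicates are computable functions
  with truth values, and enumerable sets are closed under computable preimages, decidable conditions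
  and bounded universal quantification.
\<close>

section \<open>Total recursive functions\<close>


text \<open>
  Nothing is required on lists of other lengths, so \<open>F\<close> can be any term whose values at lists of length
  \<open>k\<close> are the intended ones, such as \<open>xs ! 0\<close>.
\<close>

definition total_recursive :: "nat \<Rightarrow> (nat list \<Rightarrow> nat) \<Rightarrow> bool" where
  "total_recursive k F \<longleftrightarrow> (\<exists>f. \<forall>xs. length xs = k \<longrightarrow> rec_eval f xs (F xs))"

lemma total_recursive_cong:
  assumes "total_recursive k F" and "\<And>xs. length xs = k \<Longrightarrow> F xs = G xs"
  shows "total_recursive k G"
  using assms by (auto simp: total_recursive_def)

lemma total_recursive_nth: "i < k \<Longrightarrow> total_recursive k (\<lambda>xs. xs ! i)"
  unfolding total_recursive_def by (rule exI[of _ "Proj i"]) (auto intro: rec_eval.Proj)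

lemma total_recursive_zero: "total_recursive k (\<lambda>_. 0)"
  unfolding total_recursive_def by (rule exI[of _ Zero]) (auto intro: rec_eval.Zero)

lemma rec_eval_Comp1: "rec_eval g xs y \<Longrightarrow> rec_eval f [y] z \<Longrightarrow> rec_eval (Comp f [g]) xs z"
  by (rule rec_eval.Comp[of _ _ "[y]"]) auto

lemma rec_eval_Comp2:
  "rec_eval g xs y \<Longrightarrow> rec_eval h xs y' \<Longrightarrow> rec_eval f [y, y'] z
    \<Longrightarrow> rec_eval (Comp f [g, h]) xs z"
  by (rule rec_eval.Comp[of _ _ "[y, y']"]) auto

lemma total_recursive_comp:
  assumes "total_recursive 1 F" and "total_recursive k G"
  shows "total_recursive k (\<lambda>xs. F [G xs])"
proof -
  obtain f where "\<And>xs. length xs = 1 \<Longrightarrow> rec_eval f xs (F xs)"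
    using assms(1) by (auto simp: total_recursive_def)
  moreover obtain g where "\<And>xs. length xs = k \<Longrightarrow> rec_eval g xs (G xs)"
    using assms(2) by (auto simp: total_recursive_def)
  ultimately show ?thesis
    unfolding total_recursive_def by (intro exI[of _ "Comp f [g]"]) (auto intro!: rec_eval_Comp1)
qed

lemma total_recursive_comp2:
  assumes "total_recursive 2 F" and "total_recursive k G" and "total_recursive k H"
  shows "total_recursive k (\<lambda>xs. F [G xs, H xs])"
proof -
  obtain f where "\<And>xs. length xs = 2 \<Longrightarrow> rec_eval f xs (F xs)"
    using assms(1) by (auto simp: total_recursive_def)
  moreover obtain g where "\<And>xs. length xs = k \<Longrightarrow> rec_eval g xs (G xs)"
    using assms(2) by (auto simp: total_recursive_def)
  moreover obtain h where "\<And>xs. length xs = k \<Longrightarrow> rec_eval h xs (H xs)"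
    using assms(3) by (auto simp: total_recursive_def)
  ultimately show ?thesis
    unfolding total_recursive_def by (intro exI[of _ "Comp f [g, h]"]) (auto intro!: rec_eval_Comp2)
qed

lemma total_recursive_Suc:
  assumes "total_recursive k F"
  shows "total_recursive k (\<lambda>xs. Suc (F xs))"
proof -
  have "rec_eval Succ [x] (Suc (hd [x]))" for x
    by (simp add: rec_eval.Succ)
  then have "total_recursive 1 (\<lambda>xs. Suc (hd xs))"
    unfolding total_recursive_def by (intro exI[of _ Succ]) (auto simp: length_Suc_conv)
  from total_recursive_comp[OF this assms] show ?thesis by simp
qed

lemma total_recursive_const: "total_recursive k (\<lambda>_. c)"
  by (induction c) (auto intro: total_recursive_zero total_recursive_Suc)

lemma total_recursive_drop:
  assumes "total_recursive k F"
  shows "total_recursive (k + m) (\<lambda>xs. F (drop m xs))"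
proof -
  obtain f where f: "\<And>xs. length xs = k \<Longrightarrow> rec_eval f xs (F xs)"
    using assms by (auto simp: total_recursive_def)
  have "rec_eval (Comp f (map Proj [m..<m + k])) xs (F (drop m xs))" if "length xs = k + m" for xs
    by (rule rec_eval.Comp[of _ _ "drop m xs"])
      (use that in \<open>auto simp: list_all2_conv_all_nth intro!: f rec_eval.Proj\<close>)
  then show ?thesis
    unfolding total_recursive_def by blast
qed

text \<open>
  Combined with projections, this single rule yields all the arithmetic below: the step function sees
  the counter and the previous value in front of the unchanged arguments.
\<close>

lemma total_recursive_rec_nat:
  assumes "total_recursive k N" and "total_recursive k G"
    and "total_recursive (k + 2) (\<lambda>zs. H (zs ! 0) (zs ! 1) (drop 2 zs))"
  shows "total_recursive k (\<lambda>xs. rec_nat (G xs) (\<lambda>j s. H j s xs) (N xs))"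
proof -
  obtain n where n: "\<And>xs. length xs = k \<Longrightarrow> rec_eval n xs (N xs)"
    using assms(1) by (auto simp: total_recursive_def)
  obtain g where g: "\<And>xs. length xs = k \<Longrightarrow> rec_eval g xs (G xs)"
    using assms(2) by (auto simp: total_recursive_def)
  obtain h where "\<And>zs. length zs = k + 2 \<Longrightarrow> rec_eval h zs (H (zs ! 0) (zs ! 1) (drop 2 zs))"
    using assms(3) by (auto simp: total_recursive_def)
  then have h: "rec_eval h (j # s # xs) (H j s xs)" if "length xs = k" for j s xs
    using that by (metis (no_types, lifting) One_nat_def add_2_eq_Suc' drop0 drop_Suc_Cons length_Cons
      nth_Cons_0 nth_Cons_Suc numeral_2_eq_2)
  have rec: "rec_eval (PrimRec g h) (i # xs) (rec_nat (G xs) (\<lambda>j s. H j s xs) i)"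
    if "length xs = k" for i xs
    by (induction i) (use that g h in \<open>auto intro: rec_eval.PrimRec_0 rec_eval.PrimRec_Suc\<close>)
  have "rec_eval (Comp (PrimRec g h) (n # map Proj [0..<k])) xs
      (rec_nat (G xs) (\<lambda>j s. H j s xs) (N xs))" if "length xs = k" for xs
    by (rule rec_eval.Comp[of _ _ "N xs # xs"])
      (use that n rec in \<open>auto simp: list_all2_conv_all_nth nth_Cons' intro!: rec_eval.Proj\<close>)
  then show ?thesis
    unfolding total_recursive_def by blast
qed

lemma total_recursive_add:
  assumes "total_recursive k F" and "total_recursive k G"
  shows "total_recursive k (\<lambda>xs. F xs + G xs)"
proof -
  have "total_recursive k (\<lambda>xs. rec_nat (F xs) (\<lambda>_. Suc) (G xs))"
    by (rule total_recursive_rec_nat[where H = "\<lambda>_ s _. Suc s", OF assms(2,1)])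
      (intro total_recursive_Suc total_recursive_nth, simp)
  moreover have "rec_nat a (\<lambda>_. Suc) b = a + b" for a b :: nat
    by (induction b) auto
  ultimately show ?thesis by simp
qed

lemma total_recursive_pred:
  assumes "total_recursive k F"
  shows "total_recursive k (\<lambda>xs. F xs - 1)"
proof -
  have "total_recursive k (\<lambda>xs. rec_nat 0 (\<lambda>j _. j) (F xs))"
    by (rule total_recursive_rec_nat[where H = "\<lambda>j _ _. j", OF assms total_recursive_zero])
      (intro total_recursive_nth, simp)
  moreover have "rec_nat 0 (\<lambda>j _. j) a = a - 1" for a :: nat
    by (induction a) auto
  ultimately show ?thesis by simp
qed

lemma total_recursive_diff:
  assumes "total_recursive k F" and "total_recursive k G"
  shows "total_recursive k (\<lambda>xs. F xs - G xs)"
proof -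
  have "total_recursive k (\<lambda>xs. rec_nat (F xs) (\<lambda>_ s. s - 1) (G xs))"
    by (rule total_recursive_rec_nat[where H = "\<lambda>_ s _. s - 1", OF assms(2,1)])
      (intro total_recursive_pred total_recursive_nth, simp)
  moreover have "rec_nat a (\<lambda>_ s. s - 1) b = a - b" for a b :: nat
    by (induction b) auto
  ultimately show ?thesis by simp
qed

lemma total_recursive_mult:
  assumes "total_recursive k F" and "total_recursive k G"
  shows "total_recursive k (\<lambda>xs. F xs * G xs)"
proof -
  have "total_recursive k (\<lambda>xs. rec_nat 0 (\<lambda>_ s. s + F xs) (G xs))"
    by (rule total_recursive_rec_nat[where H = "\<lambda>_ s xs. s + F xs", OF assms(2) total_recursive_zero])
      (intro total_recursive_add total_recursive_nth total_recursive_drop assms, simp)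
  moreover have "rec_nat 0 (\<lambda>_ s. s + a) b = a * b" for a b :: nat
    by (induction b) auto
  ultimately show ?thesis by simp
qed

lemma total_recursive_if_zero:
  assumes "total_recursive k F" and "total_recursive k G" and "total_recursive k H"
  shows "total_recursive k (\<lambda>xs. if F xs = 0 then G xs else H xs)"
proof -
  have "total_recursive k (\<lambda>xs. rec_nat (G xs) (\<lambda>_ _. H xs) (F xs))"
    by (rule total_recursive_rec_nat[where H = "\<lambda>_ _ xs. H xs", OF assms(1,2)])
      (intro total_recursive_drop assms)
  moreover have "rec_nat a (\<lambda>_ _. b) c = (if c = 0 then a else b)" for a b c :: nat
    by (cases c) auto
  ultimately show ?thesis by simp
qed

lemma total_recursive_triangle:
  assumes "total_recursive k F"
  shows "total_recursive k (\<lambda>xs. triangle (F xs))"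
proof -
  have "total_recursive k (\<lambda>xs. rec_nat 0 (\<lambda>j s. s + Suc j) (F xs))"
    by (rule total_recursive_rec_nat[where H = "\<lambda>j s _. s + Suc j", OF assms total_recursive_zero])
      (intro total_recursive_add total_recursive_Suc total_recursive_nth; simp)
  moreover have "rec_nat 0 (\<lambda>j s. s + Suc j) a = triangle a" for a
    by (induction a) auto
  ultimately show ?thesis by simp
qed

lemma total_recursive_prod_encode:
  assumes "total_recursive k F" and "total_recursive k G"
  shows "total_recursive k (\<lambda>xs. prod_encode (F xs, G xs))"
  unfolding prod_encode_def prod.case
  by (intro total_recursive_add total_recursive_triangle assms)

text \<open>
  The sum of the components of \<^term>\<open>prod_decode x\<close> is the largest \<open>d\<close> with \<^prop>\<open>triangle d \<le> x\<close>.
  When \<open>x\<close> grows by one, this \<open>d\<close> grows by at most one, so it can be computed by primitive recursion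
  and the pairing function inverted without search.
\<close>

definition diagonal_index :: "nat \<Rightarrow> nat" where
  "diagonal_index x = rec_nat 0 (\<lambda>j s. if triangle (Suc s) - Suc j = 0 then Suc s else s) x"

lemma diagonal_index_bounds:
  "triangle (diagonal_index x) \<le> x \<and> x < triangle (Suc (diagonal_index x))"
  by (induction x) (auto simp: diagonal_index_def)

lemma triangle_mono: "m \<le> n \<Longrightarrow> triangle m \<le> triangle n"
  by (rule lift_Suc_mono_le[of triangle]) auto

lemma diagonal_index_eqI:
  assumes "triangle d \<le> x" and "x < triangle (Suc d)"
  shows "diagonal_index x = d"
proof (rule antisym)
  have "\<not> triangle (Suc d) \<le> triangle (diagonal_index x)"
    using diagonal_index_bounds[of x] assms by linarith
  then show "diagonal_index x \<le> d" using triangle_mono[of "Suc d" "diagonal_index x"] by linarith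
  have "\<not> triangle (Suc (diagonal_index x)) \<le> triangle d"
    using diagonal_index_bounds[of x] assms by linarith
  then show "d \<le> diagonal_index x" using triangle_mono[of "Suc (diagonal_index x)" d] by linarith
qed

lemma prod_decode_diagonal:
  "fst (prod_decode x) = x - triangle (diagonal_index x)"
  "snd (prod_decode x) = diagonal_index x - (x - triangle (diagonal_index x))"
proof -
  obtain m n where x: "x = prod_encode (m, n)" by (metis prod_decode_inverse surj_pair)
  have "diagonal_index x = m + n"
    by (rule diagonal_index_eqI) (auto simp: x prod_encode_def)
  then show "fst (prod_decode x) = x - triangle (diagonal_index x)"
    "snd (prod_decode x) = diagonal_index x - (x - triangle (diagonal_index x))"
    by (auto simp: x, auto simp: prod_encode_def)
qed

lemma total_recursive_diagonal_index:
  assumes "total_recursive k F"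
  shows "total_recursive k (\<lambda>xs. diagonal_index (F xs))"
  unfolding diagonal_index_def
  by (rule total_recursive_rec_nat[where H =
      "\<lambda>j s _. if triangle (Suc s) - Suc j = 0 then Suc s else s", OF assms total_recursive_zero])
    (intro total_recursive_if_zero total_recursive_diff total_recursive_triangle total_recursive_Suc
      total_recursive_nth; simp)

lemma total_recursive_prod_decode:
  assumes "total_recursive k F"
  shows "total_recursive k (\<lambda>xs. fst (prod_decode (F xs)))"
    and "total_recursive k (\<lambda>xs. snd (prod_decode (F xs)))"
  unfolding prod_decode_diagonal
  by (intro total_recursive_diff total_recursive_triangle total_recursive_diagonal_index assms)+

section \<open>Computable functions on coded types\<close>

text \<open>
  Only codes of elements matter: the function on numbers is arbitrary outside of the range of the
  coding. A coding need not be surjective, and its range need not be decidable.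
\<close>

definition computable :: "('a::coded \<Rightarrow> 'b::coded) \<Rightarrow> bool" where
  "computable f \<longleftrightarrow> (\<exists>F. total_recursive 1 F \<and> (\<forall>x. F [code x] = code (f x)))"

lemma computableI:
  "total_recursive 1 F \<Longrightarrow> (\<And>x. F [code x] = code (f x)) \<Longrightarrow> computable f"
  by (auto simp: computable_def)

lemma computableE:
  assumes "computable f"
  obtains F where "total_recursive 1 F" and "\<And>x. F [code x] = code (f x)"
  using assms by (auto simp: computable_def)

lemma total_recursive_arg: "total_recursive 1 (\<lambda>xs. xs ! 0)"
  by (rule total_recursive_nth) simp

lemma computable_compose:
  assumes "computable g" and "computable f"
  shows "computable (\<lambda>x. g (f x))"
proof -
  obtain F where F: "total_recursive 1 F" "\<And>x. F [code x] = code (f x)"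
    using assms(2) by (auto elim: computableE)
  obtain G where G: "total_recursive 1 G" "\<And>x. G [code x] = code (g x)"
    using assms(1) by (auto elim: computableE)
  show ?thesis
    by (rule computableI[OF total_recursive_comp[OF G(1) F(1)]]) (simp add: F G)
qed

lemma computable_id: "computable (\<lambda>x. x)"
  by (rule computableI[OF total_recursive_arg]) simp

lemma computable_const: "computable (\<lambda>_. c)"
  by (rule computableI[OF total_recursive_const[of 1 "code c"]]) simp

lemma computable_code: "computable (code :: 'a::coded \<Rightarrow> nat)"
  by (rule computableI[OF total_recursive_arg]) (simp add: code_nat_def)

lemma computable_fst:
  assumes "computable f"
  shows "computable (\<lambda>x. fst (f x))"
proof -
  obtain F where F: "total_recursive 1 F" "\<And>x. F [code x] = code (f x)"
    using assms by (auto elim: computableE)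
  show ?thesis
    by (rule computableI[OF total_recursive_prod_decode(1)[OF F(1)]]) (simp add: F code_prod_def)
qed

lemma computable_snd:
  assumes "computable f"
  shows "computable (\<lambda>x. snd (f x))"
proof -
  obtain F where F: "total_recursive 1 F" "\<And>x. F [code x] = code (f x)"
    using assms by (auto elim: computableE)
  show ?thesis
    by (rule computableI[OF total_recursive_prod_decode(2)[OF F(1)]]) (simp add: F code_prod_def)
qed

lemma computable_Pair:
  assumes "computable f" and "computable g"
  shows "computable (\<lambda>x. (f x, g x))"
proof -
  obtain F where F: "total_recursive 1 F" "\<And>x. F [code x] = code (f x)"
    using assms(1) by (auto elim: computableE)
  obtain G where G: "total_recursive 1 G" "\<And>x. G [code x] = code (g x)"
    using assms(2) by (auto elim: computableE)
  show ?thesis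
    by (rule computableI[OF total_recursive_prod_encode[OF F(1) G(1)]]) (simp add: F G code_prod_def)
qed

lemma computable_Suc:
  assumes "computable f"
  shows "computable (\<lambda>x. Suc (f x))"
proof -
  obtain F where F: "total_recursive 1 F" "\<And>x. F [code x] = code (f x)"
    using assms by (auto elim: computableE)
  show ?thesis
    by (rule computableI[OF total_recursive_Suc[OF F(1)]]) (simp add: F code_nat_def)
qed

lemma
  fixes f g :: "'a::coded \<Rightarrow> nat"
  assumes "computable f" and "computable g"
  shows computable_add: "computable (\<lambda>x. f x + g x)"
    and computable_diff: "computable (\<lambda>x. f x - g x)"
    and computable_mult: "computable (\<lambda>x. f x * g x)"
proof -
  obtain F where F: "total_recursive 1 F" "\<And>x. F [code x] = code (f x)"
    using assms(1) by (auto elim: computableE)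
  obtain G where G: "total_recursive 1 G" "\<And>x. G [code x] = code (g x)"
    using assms(2) by (auto elim: computableE)
  show "computable (\<lambda>x. f x + g x)"
    by (rule computableI[OF total_recursive_add[OF F(1) G(1)]]) (simp add: F G code_nat_def)
  show "computable (\<lambda>x. f x - g x)"
    by (rule computableI[OF total_recursive_diff[OF F(1) G(1)]]) (simp add: F G code_nat_def)
  show "computable (\<lambda>x. f x * g x)"
    by (rule computableI[OF total_recursive_mult[OF F(1) G(1)]]) (simp add: F G code_nat_def)
qed

lemma computable_if_zero:
  assumes "computable f" and "computable g" and "computable h"
  shows "computable (\<lambda>x. if f x = (0::nat) then g x else h x)"
proof -
  obtain F where F: "total_recursive 1 F" "\<And>x. F [code x] = code (f x)"
    using assms(1) by (auto elim: computableE)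
  obtain G where G: "total_recursive 1 G" "\<And>x. G [code x] = code (g x)"
    using assms(2) by (auto elim: computableE)
  obtain H where H: "total_recursive 1 H" "\<And>x. H [code x] = code (h x)"
    using assms(3) by (auto elim: computableE)
  show ?thesis
    by (rule computableI[OF total_recursive_if_zero[OF F(1) G(1) H(1)]])
      (simp add: F G H, simp add: code_nat_def)
qed

text \<open>
  The argument, the counter and the previous value are paired into one number, which makes recursion
  available inside terms with further parameters and with results of any coded type.
\<close>

lemma computable_rec_nat:
  assumes "computable n" and "computable g" and "computable (\<lambda>(x, j, s). h x j s)"
  shows "computable (\<lambda>x. rec_nat (g x) (h x) (n x))"
proof -
  obtain N where N: "total_recursive 1 N" "\<And>x. N [code x] = code (n x)"
    using assms(1) by (auto elim: computableE)
  obtain G where G: "total_recursive 1 G" "\<And>x. G [code x] = code (g x)"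
    using assms(2) by (auto elim: computableE)
  obtain H where H: "total_recursive 1 H"
    and H_eq: "\<And>p. H [code p] = code (case p of (x, j, s) \<Rightarrow> h x j s)"
    using assms(3) by (auto elim: computableE)
  define K where "K j s xs = H [prod_encode (hd xs, prod_encode (j, s))]" for j s xs
  have "total_recursive (1 + 2)
      (\<lambda>zs. H [prod_encode (zs ! 2, prod_encode (zs ! 0, zs ! 1))])"
    by (intro total_recursive_comp[OF H] total_recursive_prod_encode total_recursive_nth) auto
  then have "total_recursive (1 + 2) (\<lambda>zs. K (zs ! 0) (zs ! 1) (drop 2 zs))"
    by (rule total_recursive_cong) (simp add: K_def hd_drop_conv_nth)
  note rec = total_recursive_rec_nat[OF N(1) G(1) this]
  have "rec_nat (code (g x)) (\<lambda>j s. K j s [code x]) i = code (rec_nat (g x) (h x) i)" for x i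
  proof (induction i)
    case (Suc i)
    then show ?case
      using H_eq[of "(x, i, rec_nat (g x) (h x) i)"] by (simp add: K_def code_prod_def code_nat_def)
  qed simp
  then show ?thesis
    by (intro computableI[OF rec]) (simp add: N G, simp add: code_nat_def)
qed

subsection \<open>Lists\<close>

lemma code_Nil: "code [] = 0"
  and code_Cons: "code (x # xs) = Suc (prod_encode (code x, code xs))"
  by (simp_all add: code_list_def)

lemma computable_Cons:
  assumes "computable f" and "computable g"
  shows "computable (\<lambda>x. f x # g x)"
proof -
  obtain F where F: "total_recursive 1 F" "\<And>x. F [code x] = code (f x)"
    using assms(1) by (auto elim: computableE)
  obtain G where G: "total_recursive 1 G" "\<And>x. G [code x] = code (g x)"
    using assms(2) by (auto elim: computableE)
  show ?thesis
    by (rule computableI[OF total_recursive_Suc[OF total_recursive_prod_encode[OF F(1) G(1)]]])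
      (simp add: F G code_Cons)
qed

lemma computable_tl:
  assumes "computable f"
  shows "computable (\<lambda>x. tl (f x))"
proof -
  have "total_recursive 1 (\<lambda>xs. if xs ! 0 = 0 then 0 else snd (prod_decode (xs ! 0 - 1)))"
    by (intro total_recursive_if_zero total_recursive_prod_decode total_recursive_pred
      total_recursive_arg total_recursive_zero)
  moreover have "(if [code xs] ! 0 = 0 then 0 else snd (prod_decode ([code xs] ! 0 - 1)))
      = code (tl xs)" for xs :: "'b list"
    by (cases xs) (auto simp: code_Nil code_Cons)
  ultimately have "computable (tl :: 'b list \<Rightarrow> 'b list)" by (rule computableI)
  from computable_compose[OF this assms] show ?thesis .
qed

text \<open>
  The unspecified head of the empty list is some fixed element, so it does no harm.
\<close>

lemma computable_hd:
  assumes "computable f"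
  shows "computable (\<lambda>x. hd (f x))"
proof -
  let ?F = "\<lambda>xs. if xs ! 0 = 0 then code (hd [] :: 'b) else fst (prod_decode (xs ! 0 - 1))"
  have "total_recursive 1 ?F"
    by (intro total_recursive_if_zero total_recursive_prod_decode total_recursive_pred
      total_recursive_arg total_recursive_const)
  moreover have "?F [code xs] = code (hd xs)" for xs :: "'b list"
    by (cases xs) (auto simp: code_Nil code_Cons)
  ultimately have "computable (hd :: 'b list \<Rightarrow> 'b)" by (rule computableI)
  from computable_compose[OF this assms] show ?thesis .
qed

lemma computable_if_Nil:
  assumes "computable f" and "computable g" and "computable h"
  shows "computable (\<lambda>x. if f x = [] then g x else h x)"
proof -
  have "computable (\<lambda>x. code (f x))" using assms(1) by (rule computable_compose[OF computable_code])
  from computable_if_zero[OF this assms(2,3)] show ?thesis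
    using inj_eq[OF inj_code, of _ "[] :: 'b list"] by (simp add: code_Nil)
qed

lemma length_le_code: "length xs \<le> code xs"
proof (induction xs)
  case (Cons x xs)
  then show ?case using le_prod_encode_2[of "code xs" "code x"] by (simp add: code_Cons)
qed simp

text \<open>
  Primitive recursion along a list is reduced to primitive recursion on numbers: the rest of the
  list is carried along, and the code of the list bounds the number of steps.
\<close>

lemma computable_foldl:
  assumes f: "computable f" and g: "computable g" and h: "computable (\<lambda>(x, s, a). h x s a)"
  shows "computable (\<lambda>x. foldl (h x) (g x) (f x))"
proof -
  define step where "step x j p =
    (if snd p = [] then p else (h x (fst p) (hd (snd p)), tl (snd p)))" for x and j :: nat and p
  have steps: "rec_nat (s, xs) (step x) n = (foldl (h x) s (take n xs), drop n xs)" for x s xs n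
  proof (induction n)
    case (Suc n)
    have "rec_nat (s, xs) (step x) (Suc n) = step x n (foldl (h x) s (take n xs), drop n xs)"
      by (simp add: Suc)
    also have "\<dots> = (foldl (h x) s (take (Suc n) xs), drop (Suc n) xs)"
      by (cases "n < length xs")
        (simp_all add: step_def take_Suc_conv_app_nth hd_drop_conv_nth drop_Suc tl_drop)
    finally show ?case .
  qed simp
  have eq: "foldl (h x) (g x) (f x) =
      fst (rec_nat (g x, f x) (step x) (code (f x)))" for x
    by (simp add: steps length_le_code)
  have "computable (\<lambda>q :: 'a \<times> nat \<times> 'c \<times> 'b list. if snd (snd (snd q)) = [] then snd (snd q)
      else (h (fst q) (fst (snd (snd q))) (hd (snd (snd (snd q)))), tl (snd (snd (snd q)))))"
  proof (intro computable_if_Nil computable_Pair computable_tl computable_snd computable_id)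
    show "computable (\<lambda>q :: 'a \<times> nat \<times> 'c \<times> 'b list.
        h (fst q) (fst (snd (snd q))) (hd (snd (snd (snd q)))))"
      using computable_compose[OF h, of "\<lambda>q :: 'a \<times> nat \<times> 'c \<times> 'b list.
          (fst q, fst (snd (snd q)), hd (snd (snd (snd q))))"]
      by (simp add: computable_Pair computable_hd computable_fst computable_snd computable_id)
  qed
  then have "computable (\<lambda>(x, j, p). step x j p)"
    by (simp add: step_def case_prod_unfold)
  then show ?thesis
    unfolding eq
    by (intro computable_fst computable_rec_nat computable_Pair f g
      computable_compose[OF computable_code f])
qed

lemma computable_length: 
  assumes "computable f"
  shows "computable (\<lambda>x. length (f x))"
proof -
  have "foldl (\<lambda>s _. Suc s) n xs = n + length xs" for n and xs :: "'b list"
    by (induction xs arbitrary: n) auto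
  moreover have "computable (\<lambda>x. foldl (\<lambda>s _. Suc s) 0 (f x))"
    by (rule computable_foldl[OF assms computable_const])
      (simp add: case_prod_unfold computable_Suc computable_fst computable_snd computable_id)
  ultimately show ?thesis by simp
qed

lemma computable_rev: 
  assumes "computable f"
  shows "computable (\<lambda>x. rev (f x))"
proof -
  have "foldl (\<lambda>s a. a # s) ys xs = rev xs @ ys" for ys xs :: "'b list"
    by (induction xs arbitrary: ys) auto
  moreover have "computable (\<lambda>x. foldl (\<lambda>s a. a # s) [] (f x))"
    by (rule computable_foldl[OF assms computable_const])
      (simp add: case_prod_unfold computable_Cons computable_fst computable_snd computable_id)
  ultimately show ?thesis by simp
qed

lemma computable_map:
  assumes "computable f" and "computable g"
  shows "computable (\<lambda>x. map g (f x))"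
proof -
  have "foldl (\<lambda>s a. g a # s) ys xs = rev (map g xs) @ ys" for ys xs
    by (induction xs arbitrary: ys) auto
  moreover have "computable (\<lambda>x. rev (foldl (\<lambda>s a. g a # s) [] (f x)))"
    by (rule computable_rev, rule computable_foldl[OF assms(1) computable_const])
      (simp add: case_prod_unfold computable_Cons computable_compose[OF assms(2)] computable_fst
        computable_snd computable_id)
  ultimately show ?thesis by simp
qed

lemma computable_sum_list:
  fixes f :: "'a::coded \<Rightarrow> nat list"
  assumes "computable f"
  shows "computable (\<lambda>x. sum_list (f x))"
proof -
  have "foldl (+) n xs = n + sum_list xs" for n and xs :: "nat list"
    by (induction xs arbitrary: n) auto
  moreover have "computable (\<lambda>x. foldl (+) 0 (f x))"
    by (rule computable_foldl[OF assms computable_const])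
      (simp add: case_prod_unfold computable_add computable_fst computable_snd computable_id)
  ultimately show ?thesis by simp
qed

lemma computable_drop:
  assumes "computable n" and "computable f"
  shows "computable (\<lambda>x. drop (n x) (f x))"
proof -
  have "rec_nat xs (\<lambda>_. tl) m = drop m xs" for m and xs :: "'b list"
    by (induction m) (auto simp: drop_Suc tl_drop)
  moreover have "computable (\<lambda>x. rec_nat (f x) (\<lambda>_. tl) (n x))"
    by (rule computable_rec_nat[OF assms])
      (simp add: case_prod_unfold computable_tl computable_fst computable_snd computable_id)
  ultimately show ?thesis by simp
qed

text \<open>
  A prefix is a suffix of the reversed list, and suffixes arise by iterating \<^const>\<open>tl\<close>.
\<close>

lemma computable_take:
  assumes "computable n" and "computable f"
  shows "computable (\<lambda>x. take (n x) (f x))"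
proof -
  have "take m xs = rev (drop (length xs - m) (rev xs))" for m and xs :: "'b list"
    by (cases "m \<le> length xs") (simp_all add: rev_drop)
  moreover have "computable (\<lambda>x. rev (drop (length (f x) - n x) (rev (f x))))"
    by (intro computable_rev computable_drop computable_diff computable_length assms)
  ultimately show ?thesis by simp
qed

subsection \<open>Decidable predicates\<close>

definition decidable :: "('a::coded \<Rightarrow> bool) \<Rightarrow> bool" where
  "decidable P \<longleftrightarrow> computable (\<lambda>x. of_bool (P x) :: nat)"

lemma decidable_not:
  assumes "decidable P"
  shows "decidable (\<lambda>x. \<not> P x)"
proof -
  have "1 - of_bool (P x) = (of_bool (\<not> P x) :: nat)" for x by simp
  with computable_diff[OF computable_const[of 1] assms[unfolded decidable_def]] show ?thesis
    by (simp only: decidable_def)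
qed

lemma decidable_conj:
  assumes "decidable P" and "decidable Q"
  shows "decidable (\<lambda>x. P x \<and> Q x)"
  using computable_mult[OF assms[unfolded decidable_def]]
  by (simp add: decidable_def of_bool_conj)

lemma decidable_disj:
  assumes "decidable P" and "decidable Q"
  shows "decidable (\<lambda>x. P x \<or> Q x)"
  using decidable_not[OF decidable_conj[OF assms[THEN decidable_not]]] by simp

lemma decidable_le:
  fixes f g :: "'a::coded \<Rightarrow> nat"
  assumes "computable f" and "computable g"
  shows "decidable (\<lambda>x. f x \<le> g x)"
proof -
  have "computable (\<lambda>x. if f x - g x = 0 then 1 else 0 :: nat)"
    by (intro computable_if_zero computable_diff computable_const assms)
  then show ?thesis by (simp add: decidable_def of_bool_def)
qed

lemma decidable_eq:
  fixes f g :: "'a::coded \<Rightarrow> 'b::coded"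
  assumes "computable f" and "computable g"
  shows "decidable (\<lambda>x. f x = g x)"
proof -
  have "decidable (\<lambda>x. code (f x) \<le> code (g x) \<and> code (g x) \<le> code (f x))"
    by (intro decidable_conj decidable_le computable_compose[OF computable_code] assms)
  then show ?thesis by (simp add: eq_iff[symmetric] inj_eq[OF inj_code])
qed

lemma decidable_all_less:
  fixes n :: "'a::coded \<Rightarrow> nat"
  assumes "computable n" and "decidable (\<lambda>(x, j). P x j)"
  shows "decidable (\<lambda>x. \<forall>j<n x. P x j)"
proof -
  have "rec_nat 1 (\<lambda>j s. s * of_bool (P x j)) m = (of_bool (\<forall>j<m. P x j) :: nat)" for x :: 'a and m
    by (induction m) (auto simp: less_Suc_eq)
  moreover have "computable (\<lambda>x. rec_nat 1 (\<lambda>j s. s * of_bool (P x j)) (n x) :: nat)"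
  proof (rule computable_rec_nat[OF assms(1) computable_const])
    have "computable (\<lambda>q :: 'a \<times> nat \<times> nat. of_bool (P (fst q) (fst (snd q))) :: nat)"
      using computable_compose[OF assms(2)[unfolded decidable_def],
          of "\<lambda>q :: 'a \<times> nat \<times> nat. (fst q, fst (snd q))"]
      by (simp add: computable_Pair computable_fst computable_snd computable_id)
    then show "computable (\<lambda>(x, j, s). s * of_bool (P x j) :: nat)"
      by (simp add: case_prod_unfold computable_mult computable_snd computable_id)
  qed
  ultimately show ?thesis by (simp add: decidable_def)
qed

lemma recursive_imp_decidable:
  assumes "recursive A"
  shows "decidable (\<lambda>x. x \<in> A)"
proof -
  obtain f where f: "\<And>x. rec_eval f [x] (if x \<in> code ` A then 1 else 0)"
    using assms by (auto simp: recursive_def nat_recursive_def)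
  have "total_recursive 1 (\<lambda>xs. if hd xs \<in> code ` A then 1 else 0)"
    unfolding total_recursive_def
  proof (intro exI[of _ f] allI impI)
    fix xs :: "nat list" assume "length xs = 1"
    then obtain x where "xs = [x]" by (auto simp: length_Suc_conv)
    then show "rec_eval f xs (if hd xs \<in> code ` A then 1 else 0)" using f[of x] by simp
  qed
  then show ?thesis
    unfolding decidable_def
    by (rule computableI) (auto simp: code_nat_def inj_image_mem_iff[OF inj_code])
qed

section \<open>Recursively enumerable sets\<close>

lemma total_recursive_1E:
  assumes "total_recursive 1 F"
  obtains f where "\<And>x y. rec_eval f [x] y \<longleftrightarrow> y = F [x]"
proof -
  obtain f where f: "\<And>xs. length xs = 1 \<Longrightarrow> rec_eval f xs (F xs)"
    using assms by (auto simp: total_recursive_def)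
  have "rec_eval f [x] y \<longleftrightarrow> y = F [x]" for x y
    using f[of "[x]"] rec_eval_functional[of f "[x]"] by auto
  then show ?thesis by (rule that)
qed

lemma rec_eval_Comp1_iff:
  "rec_eval (Comp f [g]) xs z \<longleftrightarrow> (\<exists>y. rec_eval g xs y \<and> rec_eval f [y] z)"
  by (auto simp: list_all2_Cons1 elim!: rec_eval_cases(4) intro: rec_eval_Comp1)

lemma nat_re_vimage:
  assumes "nat_re S" and "total_recursive 1 F"
  shows "nat_re {x. F [x] \<in> S}"
proof -
  obtain f where "\<And>x y. rec_eval f [x] y \<longleftrightarrow> y = F [x]"
    using total_recursive_1E[OF assms(2)] by blast
  moreover obtain s where "S = {x. \<exists>y. rec_eval s [x] y}"
    using assms(1) by (auto simp: nat_re_def)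
  ultimately show ?thesis
    unfolding nat_re_def by (intro exI[of _ "Comp s [f]"]) (auto simp: rec_eval_Comp1_iff)
qed

text \<open>
  A composition is defined only if all of its inner functions are, even when the outer one ignores them.
\<close>

lemma nat_re_Int:
  assumes "nat_re S" and "nat_re T"
  shows "nat_re (S \<inter> T)"
proof -
  obtain s where s: "S = {x. \<exists>y. rec_eval s [x] y}"
    using assms(1) by (auto simp: nat_re_def)
  obtain t where t: "T = {x. \<exists>y. rec_eval t [x] y}"
    using assms(2) by (auto simp: nat_re_def)
  have "(\<exists>y. rec_eval (Comp Zero [s, t]) [x] y) \<longleftrightarrow> x \<in> S \<inter> T" for x
  proof
    assume "\<exists>y. rec_eval (Comp Zero [s, t]) [x] y"
    then show "x \<in> S \<inter> T"
      by (auto simp: s t list_all2_Cons1 elim!: rec_eval_cases(4))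
  next
    assume "x \<in> S \<inter> T"
    then show "\<exists>y. rec_eval (Comp Zero [s, t]) [x] y"
      unfolding s t by (blast intro: rec_eval_Comp2 rec_eval.Zero)
  qed
  then show ?thesis
    unfolding nat_re_def by (intro exI[of _ "Comp Zero [s, t]"]) auto
qed

text \<open>Searching for a zero of a function that ignores the search variable halts iff the value is zero.\<close>

lemma nat_re_zeros:
  assumes "total_recursive 1 F"
  shows "nat_re {x. F [x] = 0}"
proof -
  obtain f where f: "\<And>x y. rec_eval f [x] y \<longleftrightarrow> y = F [x]"
    using total_recursive_1E[OF assms] by blast
  have "rec_eval (Comp f [Proj 1]) [w, x] y \<longleftrightarrow> y = F [x]" for w x y
    by (auto simp: rec_eval_Comp1_iff f elim: rec_eval_cases(3)
        intro!: rec_eval.Proj[of 1 "[w, x]", simplified])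
  then have "(\<exists>y. rec_eval (Mu (Comp f [Proj 1])) [x] y) \<longleftrightarrow> F [x] = 0" for x
    by (auto elim!: rec_eval_cases(7) intro!: exI[of _ 0] rec_eval.Mu)
  then show ?thesis
    unfolding nat_re_def by (intro exI[of _ "Mu (Comp f [Proj 1])"]) simp
qed

text \<open>
  A primitive recursion halts iff all of its steps do, which yields bounded universal
  quantification over a semidecidable condition.
\<close>

lemma nat_re_all_less:
  assumes "nat_re S" and "total_recursive 1 N" and "total_recursive 2 G"
  shows "nat_re {x. \<forall>j<N [x]. G [j, x] \<in> S}"
proof -
  obtain n where n: "\<And>x y. rec_eval n [x] y \<longleftrightarrow> y = N [x]"
    using total_recursive_1E[OF assms(2)] by blast
  obtain s where s: "S = {x. \<exists>y. rec_eval s [x] y}"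
    using assms(1) by (auto simp: nat_re_def)
  have "total_recursive 3 (\<lambda>zs. G [zs ! 0, zs ! 2])"
    by (intro total_recursive_comp2[OF assms(3)] total_recursive_nth) auto
  then obtain g where "\<And>zs. length zs = 3 \<Longrightarrow> rec_eval g zs (G [zs ! 0, zs ! 2])"
    by (auto simp: total_recursive_def)
  from this[of "[_, _, _]"] have "rec_eval g [j, a, x] (G [j, x])" for j a x
    by (simp add: numeral_2_eq_2)
  then have g: "rec_eval g [j, a, x] y \<longleftrightarrow> y = G [j, x]" for j a x y
    using rec_eval_functional by blast
  define h where "h = Comp s [g]"
  have h: "(\<exists>z. rec_eval h [j, a, x] z) \<longleftrightarrow> G [j, x] \<in> S" for j a x
    by (auto simp: h_def rec_eval_Comp1_iff g s)
  have rec: "(\<exists>z. rec_eval (PrimRec Zero h) [i, x] z) \<longleftrightarrow> (\<forall>j<i. G [j, x] \<in> S)" for i x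
  proof (induction i)
    case 0
    show ?case by (auto intro: rec_eval.PrimRec_0 rec_eval.Zero)
  next
    case (Suc i)
    have "(\<exists>z. rec_eval (PrimRec Zero h) [Suc i, x] z) \<longleftrightarrow>
        (\<exists>y z. rec_eval (PrimRec Zero h) [i, x] y \<and> rec_eval h [i, y, x] z)"
      by (blast elim: rec_eval_cases(6) intro: rec_eval.PrimRec_Suc)
    also have "\<dots> \<longleftrightarrow> (\<forall>j<i. G [j, x] \<in> S) \<and> G [i, x] \<in> S"
      using Suc h by blast
    finally show ?case by (auto simp: less_Suc_eq)
  qed
  have proj: "rec_eval (Proj 0) [x] y \<longleftrightarrow> y = x" for x y
    using rec_eval.Proj[of 0 "[x]"] by (auto elim: rec_eval_cases(3))
  have "rec_eval (Comp (PrimRec Zero h) [n, Proj 0]) [x] z \<longleftrightarrow>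
      rec_eval (PrimRec Zero h) [N [x], x] z" for x z
    by (auto simp: list_all2_Cons1 n proj elim!: rec_eval_cases(4) intro: rec_eval_Comp2)
  then have "(\<exists>z. rec_eval (Comp (PrimRec Zero h) [n, Proj 0]) [x] z) \<longleftrightarrow>
      (\<forall>j<N [x]. G [j, x] \<in> S)" for x
    using rec[of "N [x]" x] by simp
  then show ?thesis
    unfolding nat_re_def by (intro exI[of _ "Comp (PrimRec Zero h) [n, Proj 0]"]) blast
qed

text \<open>
  The ambient set \<open>D\<close> cannot be omitted: the range of a coding need not be enumerable.
\<close>

lemma recursively_enumerable_vimage:
  assumes "recursively_enumerable D" and "recursively_enumerable C" and "computable g"
  shows "recursively_enumerable {x \<in> D. g x \<in> C}"
proof -
  obtain G where G: "total_recursive 1 G" "\<And>x. G [code x] = code (g x)"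
    using assms(3) by (auto elim: computableE)
  have "code ` {x \<in> D. g x \<in> C} = code ` D \<inter> {y. G [y] \<in> code ` C}"
    by (auto simp: G inj_eq[OF inj_code])
  then show ?thesis
    using assms(1,2) G(1) by (simp add: recursively_enumerable_def nat_re_Int nat_re_vimage)
qed

lemma recursively_enumerable_Collect:
  assumes "recursively_enumerable D" and "decidable P"
  shows "recursively_enumerable {x \<in> D. P x}"
proof -
  obtain F where F: "total_recursive 1 F" "\<And>x. F [code x] = code (of_bool (\<not> P x) :: nat)"
    using decidable_not[OF assms(2)] by (auto simp: decidable_def elim: computableE)
  have "code ` {x \<in> D. P x} = code ` D \<inter> {y. F [y] = 0}"
    by (auto simp: F code_nat_def)
  then show ?thesis
    using assms(1) F(1) by (simp add: recursively_enumerable_def nat_re_Int nat_re_zeros)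
qed

lemma recursively_enumerable_UNIV:
  assumes "surj (code :: 'a::coded \<Rightarrow> nat)"
  shows "recursively_enumerable (UNIV :: 'a set)"
  using nat_re_zeros[OF total_recursive_zero] assms by (simp add: recursively_enumerable_def)

lemma surj_code_nat: "surj (code :: nat \<Rightarrow> nat)"
  by (simp add: code_nat_def surj_def)

lemma decidable_finite:
  assumes "finite S"
  shows "decidable (\<lambda>x. x \<in> S)"
  using assms
proof (induction S)
  case empty
  then show ?case by (simp add: decidable_def computable_const)
next
  case (insert a S)
  then have "decidable (\<lambda>x. x = a \<or> x \<in> S)"
    by (intro decidable_disj decidable_eq computable_id computable_const)
  then show ?case by simp
qed

lemma recursively_enumerable_finite:
  assumes "finite S"
  shows "recursively_enumerable S"
  using recursively_enumerable_Collect[OF recursively_enumerable_UNIV[OF surj_code_nat]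
      decidable_finite[OF finite_imageI[OF assms, of code]]]
  by (simp add: recursively_enumerable_def code_nat_def)

lemma recursively_enumerable_Times:
  assumes "recursively_enumerable A" and "recursively_enumerable B"
  shows "recursively_enumerable (A \<times> B)"
proof -
  have "code ` (A \<times> B) =
      {n. fst (prod_decode n) \<in> code ` A} \<inter> {n. snd (prod_decode n) \<in> code ` B}"
  proof (intro set_eqI iffI)
    fix n
    assume "n \<in> {n. fst (prod_decode n) \<in> code ` A} \<inter> {n. snd (prod_decode n) \<in> code ` B}"
    then obtain a b where "fst (prod_decode n) = code a" "a \<in> A" "snd (prod_decode n) = code b" "b \<in> B"
      by auto
    moreover from this have "n = code (a, b)"
      using prod_decode_inverse[of n] by (cases "prod_decode n") (simp add: code_prod_def)
    ultimately show "n \<in> code ` (A \<times> B)" by auto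
  qed (auto simp: code_prod_def)
  moreover have "nat_re {n. fst (prod_decode ([n] ! 0)) \<in> code ` A}"
    using assms(1) unfolding recursively_enumerable_def
    by (rule nat_re_vimage[OF _ total_recursive_prod_decode(1)[OF total_recursive_arg]])
  moreover have "nat_re {n. snd (prod_decode ([n] ! 0)) \<in> code ` B}"
    using assms(2) unfolding recursively_enumerable_def
    by (rule nat_re_vimage[OF _ total_recursive_prod_decode(2)[OF total_recursive_arg]])
  ultimately show ?thesis by (simp add: recursively_enumerable_def nat_re_Int)
qed

text \<open>
  A list is over \<open>\<Omega>\<close> iff each of its entries is, which is a bounded quantification over a semidecidable
  condition. Since the codes of lists of numbers exhaust the natural numbers, every number can be read
  as a list of candidates for codes of elements of \<open>\<Omega>\<close>.
\<close>

lemma recursively_enumerable_lists: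
  assumes "recursively_enumerable (\<Omega> :: 'a::coded set)"
  shows "recursively_enumerable (lists \<Omega>)"
proof -
  have "computable (\<lambda>xs :: nat list. length xs)"
    by (intro computable_length computable_id)
  then obtain N where N: "total_recursive 1 N"
    and N_eq: "\<And>xs :: nat list. N [code xs] = code (length xs)"
    unfolding computable_def by blast
  have "computable (\<lambda>p :: nat \<times> nat list. hd (drop (fst p) (snd p)))"
    by (intro computable_hd computable_drop computable_fst computable_snd computable_id)
  then obtain G where G: "total_recursive 1 G"
    and G_eq: "\<And>p :: nat \<times> nat list. G [code p] = code (hd (drop (fst p) (snd p)))"
    unfolding computable_def by blast
  have "total_recursive 2 (\<lambda>zs. G [prod_encode (zs ! 0, zs ! 1)])"
    by (intro total_recursive_comp[OF G] total_recursive_prod_encode total_recursive_nth) auto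
  from nat_re_all_less[OF assms[unfolded recursively_enumerable_def] N this]
  have "nat_re {x. \<forall>j<N [x]. G [prod_encode (j, x)] \<in> code ` \<Omega>}" by simp
  also have "{x. \<forall>j<N [x]. G [prod_encode (j, x)] \<in> code ` \<Omega>} = code ` lists \<Omega>"
  proof (intro set_eqI iffI)
    fix x
    obtain ys where x: "x = list_encode ys" by (metis list_decode_inverse)
    have xc: "x = code ys" by (simp add: x code_list_def code_nat_def[abs_def])
    have "(\<forall>j<N [x]. G [prod_encode (j, x)] \<in> code ` \<Omega>) \<longleftrightarrow> (\<forall>j<length ys. ys ! j \<in> code ` \<Omega>)"
      using N_eq[of ys] G_eq[of "(_, ys)"]
      by (auto simp: xc code_prod_def code_nat_def hd_drop_conv_nth)
    also have "\<dots> \<longleftrightarrow> ys \<in> lists (code ` \<Omega>)"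
      by (auto simp: in_lists_conv_set set_conv_nth)
    also have "\<dots> \<longleftrightarrow> ys \<in> map code ` lists \<Omega>"
      by (simp add: lists_image)
    also have "\<dots> \<longleftrightarrow> x \<in> code ` lists \<Omega>"
      by (auto simp: x code_list_def image_iff list_encode_eq)
    finally have iff: "x \<in> {x. \<forall>j<N [x]. G [prod_encode (j, x)] \<in> code ` \<Omega>} \<longleftrightarrow> x \<in> code ` lists \<Omega>"
      by simp
    show "x \<in> {x. \<forall>j<N [x]. G [prod_encode (j, x)] \<in> code ` \<Omega>} \<Longrightarrow> x \<in> code ` lists \<Omega>"
      and "x \<in> code ` lists \<Omega> \<Longrightarrow> x \<in> {x. \<forall>j<N [x]. G [prod_encode (j, x)] \<in> code ` \<Omega>}"
      using iff by blast+
  qed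
  finally show ?thesis by (simp add: recursively_enumerable_def)
qed

instance recf :: countable
  by countable_datatype

lemma countable_recursively_enumerable:
  "countable {C :: 'a::coded set. recursively_enumerable C}"
proof -
  have "{S. nat_re S} \<subseteq> range (\<lambda>f. {x. \<exists>y. rec_eval f [x] y})"
    by (auto simp: nat_re_def)
  then have "countable {S. nat_re S}"
    by (rule countable_subset) simp
  then have "countable ((`) code ` {C :: 'a set. recursively_enumerable C})"
    by (rule countable_subset[rotated]) (auto simp: recursively_enumerable_def)
  then show ?thesis
    by (rule countable_image_inj_on) (auto simp: inj_on_def inj_image_eq_iff[OF inj_code])
qed



section \<open>Images of ensembles\<close>

lemma smap_in_streams: "\<alpha> \<in> streams \<Omega> \<Longrightarrow> f ` \<Omega> \<subseteq> \<Omega>' \<Longrightarrow> smap f \<alpha> \<in> streams \<Omega>'"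
  by (auto simp: streams_iff_snth)

lemma stake_in_lists: "\<alpha> \<in> streams \<Omega> \<Longrightarrow> stake n \<alpha> \<in> lists \<Omega>"
  by (auto simp: streams_iff_snth in_set_conv_nth)

lemma space_bernoulli: "space (bernoulli P) = UNIV"
  by (simp add: bernoulli_def space_stream_space)

lemma measurable_smap_bernoulli: "smap f \<in> measurable (bernoulli P) (bernoulli Q)"
  unfolding bernoulli_def by measurable

text \<open>
  Both measures in \<open>bernoulli_map_pmf\<close> below are evaluated on cylinders by this formula: one of them
  directly, and the other one with the identity in place of \<open>f\<close>.
\<close>

lemma emeasure_bernoulli_smap_vimage:
  "emeasure (bernoulli P) {\<alpha>. smap f \<alpha> \<in> sstart UNIV xs} =
    (\<Prod>x\<leftarrow>xs. emeasure (measure_pmf P) (f -` {x}))"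
proof (induction xs)
  case Nil
  then show ?case
    using prob_space.emeasure_space_1[OF prob_space_bernoulli, of P] by (simp add: space_bernoulli)
next
  case (Cons x xs)
  have "{\<alpha>. smap f \<alpha> \<in> sstart UNIV (x # xs)} \<in> sets (bernoulli P)"
    using measurable_sets[OF measurable_smap_bernoulli[of f P "map_pmf f P"], of "sstart UNIV (x # xs)"]
    by (simp add: vimage_def space_bernoulli sets_bernoulli sets_sstart)
  then have "emeasure (bernoulli P) {\<alpha>. smap f \<alpha> \<in> sstart UNIV (x # xs)} =
      (\<integral>\<^sup>+t. emeasure (bernoulli P) {\<alpha>. t ## \<alpha> \<in> {\<alpha>. smap f \<alpha> \<in> sstart UNIV (x # xs)}} \<partial>measure_pmf P)"
    unfolding bernoulli_def
    by (subst prob_space.emeasure_stream_space[OF prob_space_measure_pmf])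
      (simp_all add: space_stream_space)
  also have "\<dots> = (\<integral>\<^sup>+t. (\<Prod>x\<leftarrow>xs. emeasure (measure_pmf P) (f -` {x})) * indicator (f -` {x}) t \<partial>measure_pmf P)"
    using Cons by (intro nn_integral_cong) (auto simp: indicator_def)
  also have "\<dots> = (\<Prod>x\<leftarrow>x # xs. emeasure (measure_pmf P) (f -` {x}))"
    by (subst nn_integral_cmult_indicator) (auto simp: mult.commute)
  finally show ?case .
qed

lemma countable_coded: "countable (S :: 'a::coded set)"
  by (rule countableI[OF inj_on_subset[OF inj_code]]) simp

lemma bernoulli_map_pmf:
  fixes f :: "'a \<Rightarrow> 'b::coded"
  shows "bernoulli (map_pmf f P) = distr (bernoulli P) (bernoulli (map_pmf f P)) (smap f)"
proof (rule stream_space_eq_sstart[of UNIV])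
  interpret prob_space "bernoulli P" by (rule prob_space_bernoulli)
  show "prob_space (distr (bernoulli P) (bernoulli (map_pmf f P)) (smap f))"
    by (rule prob_space_distr[OF measurable_smap_bernoulli])
  show "emeasure (bernoulli (map_pmf f P)) (sstart UNIV xs) =
      emeasure (distr (bernoulli P) (bernoulli (map_pmf f P)) (smap f)) (sstart UNIV xs)" for xs
  proof -
    have "emeasure (distr (bernoulli P) (bernoulli (map_pmf f P)) (smap f)) (sstart UNIV xs) =
        emeasure (bernoulli P) {\<alpha>. smap f \<alpha> \<in> sstart UNIV xs}"
      by (subst emeasure_distr[OF measurable_smap_bernoulli])
        (simp_all add: sets_bernoulli sets_sstart space_bernoulli vimage_def)
    then show ?thesis
      using emeasure_bernoulli_smap_vimage[of P f xs]
        emeasure_bernoulli_smap_vimage[of "map_pmf f P" id xs]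
      by (simp add: stream.map_id)
  qed
qed (auto simp: countable_coded prob_space_bernoulli sets_bernoulli)

text \<open>
  A test \<open>C\<close> on the images pulls back to the test of all strings over \<open>\<Omega>\<close> whose images are in \<open>C\<close>. It
  is prefix-free since mapping preserves lengths, and its cylinders are contained in the preimages of those
  of \<open>C\<close>, so their measure is no larger. Enumerating it requires enumerating the strings over \<open>\<Omega>\<close>.
\<close>

lemma ensemble_smap:
  fixes \<Omega> :: "'a::coded set" and \<Omega>' :: "'b::coded set"
  assumes re: "recursively_enumerable \<Omega>" and f: "computable f" and f_in: "f ` \<Omega> \<subseteq> \<Omega>'"
    and \<alpha>: "ensemble \<Omega> P \<alpha>"
  shows "ensemble \<Omega>' (map_pmf f P) (smap f \<alpha>)"
proof -
  have "\<exists>n\<ge>1. smap f \<alpha> \<notin> cylinder \<Omega>' (C `` {n})" if C: "martin_loef_test \<Omega>' (map_pmf f P) C" for C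
  proof -
    define D where "D = {p \<in> UNIV \<times> lists \<Omega>. (fst p, map f (snd p)) \<in> C}"
    have D_iff: "\<sigma> \<in> D `` {n} \<longleftrightarrow> \<sigma> \<in> lists \<Omega> \<and> map f \<sigma> \<in> C `` {n}" for n \<sigma>
      by (auto simp: D_def)
    have cylinder_iff: "\<beta> \<in> cylinder \<Omega> (D `` {n}) \<longleftrightarrow> smap f \<beta> \<in> cylinder \<Omega>' (C `` {n})"
      if "\<beta> \<in> streams \<Omega>" for \<beta> n
      using that smap_in_streams[OF that f_in] stake_in_lists[OF that]
      by (simp add: cylinder_def D_iff del: in_lists_conv_set Image_singleton_iff)
    have "martin_loef_test \<Omega> P D"
      unfolding martin_loef_test_def
    proof (intro conjI allI impI)
      show "recursively_enumerable D"
        unfolding D_def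
      proof (rule recursively_enumerable_vimage)
        show "recursively_enumerable (UNIV \<times> lists \<Omega> :: (nat \<times> 'a list) set)"
          by (intro recursively_enumerable_Times recursively_enumerable_UNIV surj_code_nat
            recursively_enumerable_lists re)
        show "recursively_enumerable C" using C by (simp add: martin_loef_test_def)
        show "computable (\<lambda>p :: nat \<times> 'a list. (fst p, map f (snd p)))"
          by (intro computable_Pair computable_map computable_fst computable_snd computable_id f)
      qed
      show "D \<subseteq> {1..} \<times> lists \<Omega>"
        using C by (auto simp: D_def martin_loef_test_def)
      fix n :: nat assume n: "1 \<le> n"
      have "prefix_free (C `` {n})" using C n by (simp add: martin_loef_test_def)
      show "prefix_free (D `` {n})"
        unfolding prefix_free_def
      proof (intro ballI impI)
        fix \<sigma> \<tau> assume "\<sigma> \<in> D `` {n}" "\<tau> \<in> D `` {n}" "prefix \<sigma> \<tau>"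
        with \<open>prefix_free (C `` {n})\<close> have "map f \<sigma> = map f \<tau>"
          unfolding prefix_free_def D_iff using map_mono_prefix[of \<sigma> \<tau> f] by blast
        then have "length \<sigma> = length \<tau>" by (rule map_eq_imp_length_eq)
        with \<open>prefix \<sigma> \<tau>\<close> show "\<sigma> = \<tau>" by (auto simp: prefix_def)
      qed
      have "cylinder \<Omega> (D `` {n}) \<subseteq> smap f -` cylinder \<Omega>' (C `` {n}) \<inter> space (bernoulli P)"
      proof
        fix \<beta> assume "\<beta> \<in> cylinder \<Omega> (D `` {n})"
        moreover from this have "\<beta> \<in> streams \<Omega>" by (simp add: cylinder_def)
        ultimately show "\<beta> \<in> smap f -` cylinder \<Omega>' (C `` {n}) \<inter> space (bernoulli P)"
          using cylinder_iff by (simp add: space_bernoulli)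
      qed
      then have "measure (bernoulli P) (cylinder \<Omega> (D `` {n})) \<le>
          measure (bernoulli P) (smap f -` cylinder \<Omega>' (C `` {n}) \<inter> space (bernoulli P))"
        by (intro finite_measure.finite_measure_mono prob_space.finite_measure prob_space_bernoulli
          measurable_sets[OF measurable_smap_bernoulli[of _ _ "map_pmf f P"]] cylinder_measurable)
      also have "\<dots> = measure (distr (bernoulli P) (bernoulli (map_pmf f P)) (smap f)) (cylinder \<Omega>' (C `` {n}))"
        by (rule measure_distr[symmetric]) (simp_all add: measurable_smap_bernoulli cylinder_measurable)
      also have "\<dots> = measure (bernoulli (map_pmf f P)) (cylinder \<Omega>' (C `` {n}))"
        by (simp only: bernoulli_map_pmf[symmetric])
      also have "\<dots> < (1 / 2) ^ n" using C n by (simp add: martin_loef_test_def)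
      finally show "measure (bernoulli P) (cylinder \<Omega> (D `` {n})) < (1 / 2) ^ n" .
    qed
    with \<alpha> obtain n where "1 \<le> n" "\<alpha> \<notin> cylinder \<Omega> (D `` {n})" by (auto simp: ensemble_def)
    with cylinder_iff \<alpha> show ?thesis by (auto simp: ensemble_def)
  qed
  then show ?thesis
    using \<alpha> smap_in_streams[OF _ f_in] by (auto simp: ensemble_def)
qed

section \<open>Existence of ensembles\<close>

lemma AE_bernoulli_streams:
  assumes "P \<in> prob_spaces \<Omega>"
  shows "AE \<alpha> in bernoulli P. \<alpha> \<in> streams \<Omega>"
proof -
  have "AE \<alpha> in bernoulli P. \<forall>i. \<alpha> !! i \<in> \<Omega>"
    unfolding bernoulli_def
  proof (rule prob_space.AE_stream_all[OF prob_space_measure_pmf, unfolded stream_all_def])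
    show "AE a in measure_pmf P. a \<in> \<Omega>"
      using assms by (auto simp: prob_spaces_def AE_measure_pmf_iff)
  qed simp
  then show ?thesis by (simp add: streams_iff_snth)
qed

lemma AE_passes_martin_loef_test:
  fixes \<Omega> :: "'a::coded set"
  assumes "martin_loef_test \<Omega> P C"
  shows "AE \<alpha> in bernoulli P. \<exists>n\<ge>1. \<alpha> \<notin> cylinder \<Omega> (C `` {n})"
proof -
  interpret prob_space "bernoulli P" by (rule prob_space_bernoulli)
  define N where "N = (\<Inter>n\<in>{1..}. cylinder \<Omega> (C `` {n}))"
  have N: "N \<in> events"
    unfolding N_def by (intro sets.countable_INT'') (use sets.top[of "bernoulli P"] in
      \<open>simp_all add: cylinder_measurable space_bernoulli\<close>)
  have less: "prob N < (1 / 2) ^ n" if "n \<ge> 1" for n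
  proof -
    have "prob N \<le> prob (cylinder \<Omega> (C `` {n}))"
      using that by (intro finite_measure_mono cylinder_measurable) (auto simp: N_def)
    with assms that show ?thesis by (force simp: martin_loef_test_def)
  qed
  have "prob N \<le> (1 / 2) ^ Suc n" for n
    using less[of "Suc n"] by simp
  then have "prob N \<le> 0"
    by (intro LIMSEQ_le_const[OF LIMSEQ_Suc[OF LIMSEQ_realpow_zero[of "1 / 2 :: real"]]]) auto
  then have "N \<in> null_sets (bernoulli P)"
    using N by (simp add: null_sets_def emeasure_eq_measure measure_le_0_iff)
  then show ?thesis
    by (rule AE_I') (auto simp: N_def)
qed

lemma ensemble_exists:
  fixes \<Omega> :: "'a::coded set"
  assumes "P \<in> prob_spaces \<Omega>"
  shows "\<exists>\<alpha>. ensemble \<Omega> P \<alpha>"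
proof -
  have "countable {C. martin_loef_test \<Omega> P C}"
    by (rule countable_subset[OF _ countable_recursively_enumerable])
      (auto simp: martin_loef_test_def)
  then have "AE \<alpha> in bernoulli P. \<forall>C\<in>{C. martin_loef_test \<Omega> P C}. \<exists>n\<ge>1. \<alpha> \<notin> cylinder \<Omega> (C `` {n})"
    by (simp only: AE_ball_countable mem_Collect_eq) (blast intro: AE_passes_martin_loef_test)
  with AE_bernoulli_streams[OF assms] have AE: "AE \<alpha> in bernoulli P. ensemble \<Omega> P \<alpha>"
    by eventually_elim (simp add: ensemble_def)
  show ?thesis
  proof (rule ccontr)
    assume "\<nexists>\<alpha>. ensemble \<Omega> P \<alpha>"
    with AE have "AE \<alpha> in bernoulli P. False" by simp
    then show False using prob_space.AE_False[OF prob_space_bernoulli[of P]] by simp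
  qed
qed

section \<open>The law of large numbers for ensembles\<close>

definition visits :: "'a set \<Rightarrow> 'a list \<Rightarrow> nat" where
  "visits A \<sigma> = sum_list (map (\<lambda>a. of_bool (a \<in> A)) \<sigma>)"

lemma visits_stake: "visits A (stake N \<alpha>) = (\<Sum>i<N. of_bool (\<alpha> !! i \<in> A))"
  by (induction N) (simp_all add: visits_def stake_Suc del: stake.simps(2))

lemma visits_Compl: "visits A \<sigma> + visits (- A) \<sigma> = length \<sigma>"
  by (induction \<sigma>) (auto simp: visits_def)

text \<open>
  Independence and identical distribution of the coordinates, in the multiplicative form that the
  exponential moment bound requires.
\<close>

lemma nn_integral_bernoulli_prod:
  "(\<integral>\<^sup>+\<alpha>. (\<Prod>i<N. w (\<alpha> !! i)) \<partial>bernoulli P) = (\<integral>\<^sup>+a. w a \<partial>measure_pmf P) ^ N"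
proof (induction N)
  case 0
  then show ?case
    using prob_space.emeasure_space_1[OF prob_space_bernoulli, of P] by simp
next
  case (Suc N)
  have meas [measurable]: "(\<lambda>\<alpha>. \<Prod>i<N. w (\<alpha> !! i)) \<in> borel_measurable (stream_space (measure_pmf P))" for N
    by (intro borel_measurable_prod_ennreal measurable_compose[OF measurable_snth]) simp
  have "(\<integral>\<^sup>+\<alpha>. (\<Prod>i<Suc N. w (\<alpha> !! i)) \<partial>bernoulli P) =
      (\<integral>\<^sup>+a. (\<integral>\<^sup>+\<alpha>. w a * (\<Prod>i<N. w (\<alpha> !! i)) \<partial>bernoulli P) \<partial>measure_pmf P)"
    unfolding bernoulli_def
    by (subst prob_space.nn_integral_stream_space[OF prob_space_measure_pmf meas])
      (simp add: prod.lessThan_Suc_shift del: prod.lessThan_Suc)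
  also have "\<dots> = (\<integral>\<^sup>+a. w a * (\<integral>\<^sup>+\<alpha>. (\<Prod>i<N. w (\<alpha> !! i)) \<partial>bernoulli P) \<partial>measure_pmf P)"
    unfolding bernoulli_def by (intro nn_integral_cong nn_integral_cmult meas)
  also have "\<dots> = (\<integral>\<^sup>+a. w a \<partial>measure_pmf P) ^ Suc N"
    unfolding Suc by (subst nn_integral_multc) auto
  finally show ?case .
qed

text \<open>
  For \<open>0 \<le> p \<le> 1\<close>, this is the exponential moment of \<open>X - q\<close> for a Bernoulli variable \<open>X\<close> with parameter \<open>p\<close>. At \<open>s = 0\<close> it
  equals \<open>1\<close> with slope \<open>p - q < 0\<close>, so it is smaller for small positive \<open>s\<close>.
\<close>

lemma exponential_tilt_less_1:
  fixes p q :: real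
  assumes "p < q"
  shows "\<exists>s>0. p * exp (s * (1 - q)) + (1 - p) * exp (- s * q) < 1"
proof -
  define g where "g s = p * exp (s * (1 - q)) + (1 - p) * exp (- s * q)" for s
  have "(g has_real_derivative p - q) (at 0)"
    unfolding g_def by (auto intro!: derivative_eq_intros simp: algebra_simps)
  from DERIV_neg_dec_right[OF this] assms obtain d where "d > 0" "\<And>h. 0 < h \<Longrightarrow> h < d \<Longrightarrow> g h < g 0"
    by auto
  from this(1) this(2)[of "d / 2"] show ?thesis
    by (intro exI[of _ "d / 2"]) (simp add: g_def)
qed

text \<open>
  The Chernoff bound: Markov's inequality for the exponential of \<open>s * (visits - q * N)\<close>, whose expectation
  is the \<open>N\<close>th power of the exponential moment for a single step.
\<close>

lemma bernoulli_large_deviation: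
  fixes q :: real
  assumes "measure_pmf.prob P A < q"
  obtains \<rho> :: real where "0 \<le> \<rho>" "\<rho> < 1"
    "\<And>N. {\<alpha>. q * N \<le> visits A (stake N \<alpha>)} \<in> sets (bernoulli P)"
    "\<And>N. emeasure (bernoulli P) {\<alpha>. q * N \<le> visits A (stake N \<alpha>)} \<le> ennreal (\<rho> ^ N)"
proof -
  define p where "p = measure_pmf.prob P A"
  have p: "0 \<le> p" "p \<le> 1" by (simp_all add: p_def)
  obtain s where s: "s > 0" "p * exp (s * (1 - q)) + (1 - p) * exp (- s * q) < 1"
    using exponential_tilt_less_1[of p q] assms by (auto simp: p_def)
  define \<rho> where "\<rho> = p * exp (s * (1 - q)) + (1 - p) * exp (- s * q)"
  have \<rho>: "0 \<le> \<rho>" "\<rho> < 1" using p s by (simp_all add: \<rho>_def)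
  define w where "w a = ennreal (exp (s * (of_bool (a \<in> A) - q)))" for a
  have "(\<integral>\<^sup>+a. w a \<partial>measure_pmf P) =
      (\<integral>\<^sup>+a. ennreal (exp (s * (1 - q))) * indicator A a + ennreal (exp (- s * q)) * indicator (- A) a
        \<partial>measure_pmf P)"
    by (intro nn_integral_cong) (auto simp: w_def indicator_def)
  also have "\<dots> = ennreal (exp (s * (1 - q))) * ennreal p + ennreal (exp (- s * q)) * ennreal (1 - p)"
    by (subst nn_integral_add)
      (auto simp: nn_integral_cmult_indicator measure_pmf.emeasure_eq_measure p_def
        measure_pmf.prob_compl[of A P, simplified] Compl_eq_Diff_UNIV)
  also have "\<dots> = ennreal \<rho>"
    using p by (simp add: \<rho>_def ennreal_mult[symmetric] ennreal_plus[symmetric] mult.commute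
      del: ennreal_plus)
  finally have w_integral: "(\<integral>\<^sup>+a. w a \<partial>measure_pmf P) = ennreal \<rho>" .
  have meas: "{\<alpha>. q * N \<le> visits A (stake N \<alpha>)} \<in> sets (bernoulli P)" for N
  proof -
    have "(\<lambda>\<alpha>. \<Sum>i<N. of_bool (\<alpha> !! i \<in> A) :: real) \<in> borel_measurable (stream_space (measure_pmf P))"
      by (intro borel_measurable_sum measurable_compose[OF measurable_snth]) simp
    then have "{\<alpha> \<in> space (stream_space (measure_pmf P)). q * N \<le> (\<Sum>i<N. of_bool (\<alpha> !! i \<in> A))}
        \<in> sets (stream_space (measure_pmf P))"
      by measurable
    then show ?thesis by (simp add: visits_stake bernoulli_def space_stream_space)
  qed
  have "emeasure (bernoulli P) {\<alpha>. q * N \<le> visits A (stake N \<alpha>)} \<le> ennreal (\<rho> ^ N)" for N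
  proof -
    have "indicator {\<alpha>. q * N \<le> visits A (stake N \<alpha>)} \<alpha> \<le> (\<Prod>i<N. w (\<alpha> !! i))" for \<alpha>
    proof -
      have "(\<Prod>i<N. w (\<alpha> !! i)) = ennreal (\<Prod>i<N. exp (s * (of_bool (\<alpha> !! i \<in> A) - q)))"
        by (simp add: w_def prod_ennreal)
      also have "\<dots> = ennreal (exp (s * (visits A (stake N \<alpha>) - q * N)))"
        by (simp add: exp_sum[symmetric] visits_stake sum_distrib_left[symmetric] sum_subtractf mult.commute)
      finally show ?thesis using s(1) by (auto simp: indicator_def)
    qed
    then have "(\<integral>\<^sup>+\<alpha>. indicator {\<alpha>. q * N \<le> visits A (stake N \<alpha>)} \<alpha> \<partial>bernoulli P) \<le>
        (\<integral>\<^sup>+\<alpha>. (\<Prod>i<N. w (\<alpha> !! i)) \<partial>bernoulli P)"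
      by (intro nn_integral_mono)
    then show ?thesis
      using meas[of N] \<rho>(1) by (simp add: nn_integral_bernoulli_prod w_integral ennreal_power)
  qed
  with \<rho> meas show ?thesis by (rule that)
qed

text \<open>
  The upper half of the law of large numbers. With a rational \<open>r\<close> between the probability of \<open>A\<close> and
  \<open>q\<close>, the sequences with frequency at least \<open>r\<close> at time \<open>N\<close> have measure at most \<open>\<rho> ^ N\<close> for some \<open>\<rho> < 1\<close>.
  The geometric tail from time \<open>K * n + L\<close> on is less than \<open>(1 / 2) ^ n\<close> for suitable \<open>K\<close> and \<open>L\<close>. Hence the
  event that some such time is bad is the \<open>n\<close>th level of a test; the strings that are bad for the first
  time make it prefix-free. Passing the test at level \<open>n\<close> means that no time from \<open>K * n + L\<close> on is bad.
\<close>

lemma ensemble_eventually_frequency_less: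
  fixes \<Omega> :: "'a::coded set" and q :: real
  assumes re: "recursively_enumerable \<Omega>" and A: "decidable (\<lambda>a. a \<in> A)"
    and \<alpha>: "ensemble \<Omega> P \<alpha>" and q: "measure_pmf.prob P A < q"
  shows "eventually (\<lambda>N. visits A (stake N \<alpha>) < q * N) sequentially"
proof -
  obtain r where r: "r \<in> \<rat>" "measure_pmf.prob P A < r" "r < q"
    using Rats_dense_in_real[OF q] by blast
  then have "0 < r" by (meson le_less_trans measure_nonneg)
  from r(1) obtain u v :: nat where "v \<noteq> 0" "\<bar>r\<bar> = u / v"
    by (rule Rats_abs_nat_div_natE)
  with \<open>0 < r\<close> have v: "v > 0" and r_eq: "r = u / v" by auto
  obtain \<rho> where \<rho>: "0 \<le> \<rho>" "\<rho> < 1"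
    and meas: "\<And>N. {\<beta>. r * N \<le> visits A (stake N \<beta>)} \<in> sets (bernoulli P)"
    and dev: "\<And>N. emeasure (bernoulli P) {\<beta>. r * N \<le> visits A (stake N \<beta>)} \<le> ennreal (\<rho> ^ N)"
    using bernoulli_large_deviation[OF r(2)] by blast
  \<comment> \<open>\<open>K\<close> gains a factor of at least \<open>2\<close> per level, and \<open>L\<close> absorbs the sum of the geometric series.\<close>
  obtain K where K: "\<rho> ^ K < 1 / 2" using real_arch_pow_inv[of "1 / 2" \<rho>] \<rho> by auto
  obtain L where L: "\<rho> ^ L < 1 - \<rho>" using real_arch_pow_inv[of "1 - \<rho>" \<rho>] \<rho> by auto
  define bad where "bad n \<sigma> \<longleftrightarrow> K * n + L \<le> length \<sigma> \<and> u * length \<sigma> \<le> v * visits A \<sigma>" for n and \<sigma> :: "'a list"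
  have bad_stake: "bad n (stake N \<beta>) \<longleftrightarrow> K * n + L \<le> N \<and> r * N \<le> visits A (stake N \<beta>)" for n N \<beta>
  proof -
    have "r * N \<le> visits A (stake N \<beta>) \<longleftrightarrow> real (u * N) \<le> real (v * visits A (stake N \<beta>))"
      using v by (simp add: r_eq field_simps)
    then show ?thesis by (simp add: bad_def del: of_nat_mult)
  qed
  define C where "C = {p \<in> UNIV \<times> lists \<Omega>. 1 \<le> fst p \<and> bad (fst p) (snd p) \<and>
    (\<forall>j<length (snd p). \<not> bad (fst p) (take j (snd p)))}"
  have C_iff: "\<sigma> \<in> C `` {n} \<longleftrightarrow>
      \<sigma> \<in> lists \<Omega> \<and> 1 \<le> n \<and> bad n \<sigma> \<and> (\<forall>j<length \<sigma>. \<not> bad n (take j \<sigma>))" for n \<sigma>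
    by (auto simp: C_def)
  have cylinder_iff: "\<beta> \<in> cylinder \<Omega> (C `` {n}) \<longleftrightarrow> \<beta> \<in> streams \<Omega> \<and> (\<exists>N. bad n (stake N \<beta>))"
    if n: "1 \<le> n" for n \<beta>
  proof
    assume "\<beta> \<in> streams \<Omega> \<and> (\<exists>N. bad n (stake N \<beta>))"
    moreover define N where "N = (LEAST N. bad n (stake N \<beta>))"
    ultimately have "\<beta> \<in> streams \<Omega>" "bad n (stake N \<beta>)" "\<And>j. j < N \<Longrightarrow> \<not> bad n (stake j \<beta>)"
      by (auto intro: LeastI dest: not_less_Least)
    then have "stake N \<beta> \<in> C `` {n}"
      using n stake_in_lists[of \<beta> \<Omega> N] by (simp add: C_iff take_stake min_def del: Image_singleton_iff in_lists_conv_set)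
    with \<open>\<beta> \<in> streams \<Omega>\<close> show "\<beta> \<in> cylinder \<Omega> (C `` {n})" by (auto simp: cylinder_def)
  qed (auto simp: cylinder_def C_iff simp del: Image_singleton_iff)
  have "martin_loef_test \<Omega> P C"
    unfolding martin_loef_test_def
  proof (intro conjI allI impI)
    have visits: "computable (\<lambda>x. visits A (f x))" if "computable f" for f :: "'c::coded \<Rightarrow> 'a list"
      unfolding visits_def
      by (rule computable_sum_list[OF computable_map[OF that A[unfolded decidable_def]]])
    have bad: "decidable (\<lambda>x. bad (f x) (g x))" if "computable f" "computable g"
      for f and g :: "'c::coded \<Rightarrow> 'a list"
      unfolding bad_def
      by (intro decidable_conj decidable_le computable_add computable_mult computable_const
        computable_length visits that)
    show "recursively_enumerable C"
      unfolding C_def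
    proof (rule recursively_enumerable_Collect)
      show "recursively_enumerable (UNIV \<times> lists \<Omega> :: (nat \<times> 'a list) set)"
        by (intro recursively_enumerable_Times recursively_enumerable_UNIV surj_code_nat
          recursively_enumerable_lists re)
      show "decidable (\<lambda>p. 1 \<le> fst p \<and> bad (fst p) (snd p) \<and>
          (\<forall>j<length (snd p). \<not> bad (fst p) (take j (snd p))))"
        unfolding case_prod_unfold
        by (intro decidable_conj decidable_all_less decidable_le computable_length computable_const
            computable_fst computable_snd computable_id bad)
          (simp add: case_prod_unfold, intro decidable_not bad computable_take computable_fst
            computable_snd computable_id)
    qed
    show "C \<subseteq> {1..} \<times> lists \<Omega>" by (auto simp: C_def)
    fix n :: nat assume n: "1 \<le> n"
    show "prefix_free (C `` {n})"
      unfolding prefix_free_def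
    proof (intro ballI impI)
      fix \<sigma> \<tau> assume *: "\<sigma> \<in> C `` {n}" "\<tau> \<in> C `` {n}" "prefix \<sigma> \<tau>"
      then obtain \<tau>' where \<tau>: "\<tau> = \<sigma> @ \<tau>'" by (auto simp: prefix_def)
      have "\<not> length \<sigma> < length \<tau>"
      proof
        assume "length \<sigma> < length \<tau>"
        with *(2) have "\<not> bad n (take (length \<sigma>) \<tau>)" by (simp add: C_iff del: Image_singleton_iff)
        with *(1) show False by (simp add: C_iff \<tau> del: Image_singleton_iff)
      qed
      then show "\<sigma> = \<tau>" by (simp add: \<tau>)
    qed
    define M where "M = K * n + L"
    let ?D = "\<lambda>N. {\<beta>. r * N \<le> visits A (stake N \<beta>)}"
    have D: "range (\<lambda>i. ?D (i + M)) \<subseteq> sets (bernoulli P)"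
      by (rule image_subsetI) (rule meas)
    have "cylinder \<Omega> (C `` {n}) \<subseteq> (\<Union>i. ?D (i + M))"
    proof
      fix \<beta> assume "\<beta> \<in> cylinder \<Omega> (C `` {n})"
      then obtain N where "M \<le> N" "\<beta> \<in> ?D N"
        using cylinder_iff[OF n] by (auto simp: bad_stake M_def)
      then show "\<beta> \<in> (\<Union>i. ?D (i + M))"
        by (auto intro!: exI[of _ "N - M"])
    qed
    then have "emeasure (bernoulli P) (cylinder \<Omega> (C `` {n})) \<le> emeasure (bernoulli P) (\<Union>i. ?D (i + M))"
      using D by (intro emeasure_mono sets.countable_UN) auto
    also have "\<dots> \<le> (\<Sum>i. emeasure (bernoulli P) (?D (i + M)))"
      by (rule emeasure_subadditive_countably[OF D])
    also have "\<dots> \<le> (\<Sum>i. ennreal (\<rho> ^ (i + M)))"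
      by (intro suminf_le dev) auto
    also have "\<dots> = ennreal (\<rho> ^ M / (1 - \<rho>))"
    proof (rule suminf_ennreal_eq)
      show "(\<lambda>i. \<rho> ^ (i + M)) sums (\<rho> ^ M / (1 - \<rho>))"
        using sums_mult[OF geometric_sums[of \<rho>], of "\<rho> ^ M"] \<rho>
        by (simp add: power_add mult.commute)
    qed (use \<rho> in simp)
    finally have "measure (bernoulli P) (cylinder \<Omega> (C `` {n})) \<le> \<rho> ^ M / (1 - \<rho>)"
      unfolding finite_measure.emeasure_eq_measure[OF prob_space.finite_measure[OF prob_space_bernoulli]]
      using \<rho> by (subst (asm) ennreal_le_iff) auto
    also have "\<dots> = (\<rho> ^ K) ^ n * (\<rho> ^ L / (1 - \<rho>))"
      by (simp add: M_def power_add power_mult)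
    also have "\<dots> \<le> (1 / 2) ^ n * (\<rho> ^ L / (1 - \<rho>))"
      using \<rho> K by (intro mult_right_mono power_mono) auto
    also have "\<dots> < (1 / 2) ^ n * 1"
      using \<rho> L by (intro mult_strict_left_mono) auto
    finally show "measure (bernoulli P) (cylinder \<Omega> (C `` {n})) < (1 / 2) ^ n" by simp
  qed
  with \<alpha> obtain n where n: "1 \<le> n" "\<alpha> \<notin> cylinder \<Omega> (C `` {n})" and \<alpha>_in: "\<alpha> \<in> streams \<Omega>"
    by (auto simp: ensemble_def)
  have "visits A (stake N \<alpha>) < q * N" if N: "Suc (K * n + L) \<le> N" for N
  proof -
    have "\<not> bad n (stake N \<alpha>)" using n \<alpha>_in cylinder_iff by blast
    then have "visits A (stake N \<alpha>) < r * N" using N by (simp add: bad_stake)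
    also have "\<dots> \<le> q * N" using r(3) by (intro mult_right_mono) auto
    finally show ?thesis .
  qed
  then show ?thesis by (auto simp: eventually_sequentially)
qed

text \<open>
  If \<open>q\<close> separates the two probabilities, the frequency of \<open>A\<close> is eventually below \<open>q\<close> by randomness for \<open>P\<close>,
  and that of the complement eventually below \<open>1 - q\<close> by randomness for \<open>Q\<close>, but they add up to \<open>1\<close>.
\<close>

lemma ensemble_prob_le:
  fixes \<Omega> :: "'a::coded set"
  assumes re: "recursively_enumerable \<Omega>" and A: "decidable (\<lambda>a. a \<in> A)"
    and P: "ensemble \<Omega> P \<alpha>" and Q: "ensemble \<Omega> Q \<alpha>"
  shows "measure_pmf.prob Q A \<le> measure_pmf.prob P A"
proof (rule ccontr)
  assume "\<not> ?thesis"
  then obtain q where q: "measure_pmf.prob P A < q" "q < measure_pmf.prob Q A"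
    using dense[of "measure_pmf.prob P A" "measure_pmf.prob Q A"] by auto
  have "decidable (\<lambda>a. a \<in> - A)"
    using decidable_not[OF A] by simp
  moreover have "measure_pmf.prob Q (- A) < 1 - q"
    using q(2) measure_pmf.prob_compl[of A Q] by (simp add: Compl_eq_Diff_UNIV)
  ultimately have "eventually (\<lambda>N. visits (- A) (stake N \<alpha>) < (1 - q) * N) sequentially"
    by (rule ensemble_eventually_frequency_less[OF re _ Q])
  with ensemble_eventually_frequency_less[OF re A P q(1)]
  have "eventually (\<lambda>N :: nat. False) sequentially"
  proof eventually_elim
    case (elim N)
    have "real (visits A (stake N \<alpha>)) + real (visits (- A) (stake N \<alpha>)) = N"
      using visits_Compl[of A "stake N \<alpha>"] by (simp flip: of_nat_add)
    with elim show False by (simp add: algebra_simps)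
  qed
  then show False by simp
qed

lemma ensemble_determines_pmf:
  fixes \<Omega> :: "'a::coded set"
  assumes "recursively_enumerable \<Omega>" and "ensemble \<Omega> P \<alpha>" and "ensemble \<Omega> Q \<alpha>"
  shows "P = Q"
proof (rule pmf_eqI)
  fix a
  have "decidable (\<lambda>x :: 'a. x \<in> {a})" by (rule decidable_finite) simp
  from ensemble_prob_le[OF assms(1) this assms(2,3)] ensemble_prob_le[OF assms(1) this assms(3,2)]
  show "pmf P a = pmf Q a" by (simp add: measure_pmf_single)
qed

section \<open>Independent events\<close>

definition event_vector :: "(nat \<Rightarrow> 'a set) \<Rightarrow> nat \<Rightarrow> 'a \<Rightarrow> nat list" where
  "event_vector A n a = map (\<lambda>i. of_bool (a \<in> A i)) [1..<Suc n]"

lemma event_pmf_eq_map_pmf: "event_pmf P A = map_pmf (\<lambda>a. of_bool (a \<in> A)) P"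
proof -
  have eq: "map_pmf (\<lambda>a. a \<in> A) P = bernoulli_pmf (measure_pmf.prob P A)"
  proof (rule pmf_eqI)
    fix b
    have "pmf (map_pmf (\<lambda>a. a \<in> A) P) True = measure_pmf.prob P A"
      by (simp add: pmf_map vimage_def)
    moreover have "pmf (map_pmf (\<lambda>a. a \<in> A) P) False = 1 - measure_pmf.prob P A"
      using measure_pmf.prob_compl[of A P] by (simp add: pmf_map vimage_def Compl_eq_Diff_UNIV[symmetric] Compl_eq)
    ultimately show "pmf (map_pmf (\<lambda>a. a \<in> A) P) b = pmf (bernoulli_pmf (measure_pmf.prob P A)) b"
      by (cases b) simp_all
  qed
  then show ?thesis
    unfolding event_pmf_def eq[symmetric] by (simp add: pmf.map_comp o_def)
qed

lemma length_in_set_product_pmf: "l \<in> set_pmf (product_pmf Ps) \<Longrightarrow> length l = length Ps"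
  by (induction Ps arbitrary: l) auto

lemma measure_product_pmf:
  fixes Ps :: "'a::coded pmf list"
  assumes "length Bs = length Ps"
  shows "measure_pmf.prob (product_pmf Ps) (listset Bs) = (\<Prod>(P, B)\<leftarrow>zip Ps Bs. measure_pmf.prob P B)"
  using assms
proof (induction Ps arbitrary: Bs)
  case (Cons P Ps)
  then obtain B Bs' where Bs: "Bs = B # Bs'" and len: "length Bs' = length Ps"
    by (cases Bs) auto
  have "(\<lambda>(a, as). a # as) -` listset Bs = B \<times> listset Bs'"
    by (auto simp: Bs set_Cons_def)
  then show ?case
    by (simp add: Bs Cons.IH[OF len] measure_pmf_prob_product countable_coded)
qed auto

text \<open>
  The vector of \<open>a\<close> equals \<open>l\<close> iff \<open>a\<close> lies in all of the sets \<open>B i\<close>, each of which is \<open>A i\<close>, its complement or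
  empty. These sets belong to the \<open>\<sigma>\<close>-algebra generated by \<open>A i\<close>, and independence passes from events to the
  \<open>\<sigma>\<close>-algebras that they generate.
\<close>

lemma indep_events_imp_product_pmf:
  assumes "n \<ge> 1" and indep: "prob_space.indep_events (measure_pmf P) A {1..n}"
  shows "map_pmf (event_vector A n) P = product_pmf (map (\<lambda>i. event_pmf P (A i)) [1..<Suc n])"
    (is "?R = ?Q")
proof (rule pmf_eqI)
  fix l
  show "pmf ?R l = pmf ?Q l"
  proof (cases "length l = n")
    case False
    then have "l \<notin> set_pmf ?R" "l \<notin> set_pmf ?Q"
      by (auto simp: event_vector_def dest: length_in_set_product_pmf)
    then show ?thesis by (simp only: set_pmf_iff not_not)
  next
    case True
    define B where "B i = {a. of_bool (a \<in> A i) = l ! (i - 1)}" for i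
    have B_cases: "B i \<in> {{}, A i, - A i}" for i
    proof -
      have "B i = (if l ! (i - 1) = 1 then A i else if l ! (i - 1) = 0 then - A i else {})"
        by (auto simp: B_def)
      then show ?thesis by simp
    qed
    have B_sigma: "B i \<in> sigma_sets UNIV {A i}" for i
    proof -
      have "A i \<in> sigma_sets UNIV {A i}" by (rule sigma_sets.Basic) simp
      moreover from sigma_sets.Compl[OF this] have "- A i \<in> sigma_sets UNIV {A i}"
        by (simp add: Compl_eq_Diff_UNIV)
      ultimately show ?thesis using B_cases[of i] by (auto intro: sigma_sets.Empty)
    qed
    have "prob_space.indep_sets (measure_pmf P) (\<lambda>i. sigma_sets UNIV {A i}) {1..n}"
      using prob_space.indep_sets_sigma[OF prob_space_measure_pmf[of P], of "\<lambda>i. {A i}" "{1..n}"] indep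
      by (simp add: prob_space.indep_events_def_alt[OF prob_space_measure_pmf] Int_stable_def)
    then have "measure_pmf.prob P (\<Inter>i\<in>{1..n}. B i) = (\<Prod>i\<in>{1..n}. measure_pmf.prob P (B i))"
      using B_sigma assms(1) by (intro prob_space.indep_setsD[OF prob_space_measure_pmf]) auto
    moreover have "event_vector A n -` {l} = (\<Inter>i\<in>{1..n}. B i)"
    proof (rule set_eqI)
      fix a
      have "event_vector A n a = l \<longleftrightarrow> (\<forall>k<n. of_bool (a \<in> A (Suc k)) = l ! k)"
        using True by (auto simp: event_vector_def list_eq_iff_nth_eq simp del: upt_Suc)
      also have "\<dots> \<longleftrightarrow> (\<forall>i\<in>Suc ` {..<n}. a \<in> B i)"
        by (auto simp: B_def)
      finally have "event_vector A n a = l \<longleftrightarrow> (\<forall>i\<in>{1..n}. a \<in> B i)"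
        by (simp only: image_Suc_lessThan)
      then show "a \<in> event_vector A n -` {l} \<longleftrightarrow> a \<in> (\<Inter>i\<in>{1..n}. B i)" by simp
    qed
    ultimately have "pmf ?R l = (\<Prod>i\<in>{1..n}. measure_pmf.prob P (B i))"
      by (simp add: pmf_map)
    also have "\<dots> = (\<Prod>k<n. pmf (event_pmf P (A (Suc k))) (l ! k))"
      by (rule prod.reindex_bij_witness[of _ Suc "\<lambda>i. i - 1"])
        (auto simp: B_def event_pmf_eq_map_pmf pmf_map vimage_def)
    also have "\<dots> = pmf ?Q l"
      using True by (simp add: pmf_product_pmf prod.list_conv_set_nth atLeast0LessThan del: upt_Suc)
    finally show ?thesis .
  qed
qed

text \<open>
  The intersection of a subfamily is the preimage of a box whose sides are \<open>{1}\<close> for the chosen indices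
  and everything for the others.
\<close>

lemma product_pmf_imp_indep_events:
  assumes "map_pmf (event_vector A n) P = product_pmf (map (\<lambda>i. event_pmf P (A i)) [1..<Suc n])"
  shows "prob_space.indep_events (measure_pmf P) A {1..n}"
proof (rule prob_space.indep_eventsI[OF prob_space_measure_pmf])
  fix J assume J: "J \<subseteq> {1..n}" "finite J" "J \<noteq> {}"
  define B where "B i = (if i \<in> J then {1 :: nat} else UNIV)" for i
  define Bs where "Bs = map B [1..<Suc n]"
  have listset_iff: "l \<in> listset (map F xs) \<longleftrightarrow> list_all2 (\<lambda>y x. y \<in> F x) l xs"
    for l :: "nat list" and F and xs :: "nat list"
    by (induction xs arbitrary: l) (auto simp: set_Cons_def list_all2_Cons2)
  have "event_vector A n -` listset Bs = (\<Inter>j\<in>J. A j)"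
  proof (rule set_eqI)
    fix a
    have "a \<in> event_vector A n -` listset Bs \<longleftrightarrow> (\<forall>i\<in>{1..n}. i \<in> J \<longrightarrow> a \<in> A i)"
      by (auto simp: Bs_def listset_iff event_vector_def B_def list_all2_map1 list_all2_same
          atLeastLessThanSuc_atLeastAtMost simp del: upt_Suc)
    also have "\<dots> \<longleftrightarrow> a \<in> (\<Inter>j\<in>J. A j)"
      using J(1) by blast
    finally show "a \<in> event_vector A n -` listset Bs \<longleftrightarrow> a \<in> (\<Inter>j\<in>J. A j)" .
  qed
  then have "measure_pmf.prob P (\<Inter>j\<in>J. A j) =
      measure_pmf.prob (product_pmf (map (\<lambda>i. event_pmf P (A i)) [1..<Suc n])) (listset Bs)"
    by (simp only: assms[symmetric] measure_map_pmf)
  also have "\<dots> = (\<Prod>i\<in>{1..n}. measure_pmf.prob (event_pmf P (A i)) (B i))"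
    by (subst measure_product_pmf)
      (simp_all add: Bs_def zip_map_map zip_same_conv_map o_def prod.distinct_set_conv_list[symmetric]
        atLeastLessThanSuc_atLeastAtMost del: upt_Suc)
  also have "\<dots> = (\<Prod>i\<in>{1..n}. if i \<in> J then measure_pmf.prob P (A i) else 1)"
    using pmf_event_pmf(1) by (intro prod.cong) (auto simp: B_def measure_pmf_single)
  also have "\<dots> = (\<Prod>j\<in>J. measure_pmf.prob P (A j))"
    using J(1) by (simp add: prod.If_cases Int_absorb1)
  finally show "measure_pmf.prob P (\<Inter>j\<in>J. A j) = (\<Prod>j\<in>J. measure_pmf.prob P (A j))" .
qed simp

theorem theorem47:
  fixes \<Omega> :: "'a::coded set" and P :: "'a pmf" and n :: nat and A :: "nat \<Rightarrow> 'a set"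
  assumes "infinite \<Omega>" and "recursively_enumerable \<Omega>"
    and "P \<in> prob_spaces \<Omega>"
    and "n \<ge> 1"
    and "\<And>i. i \<in> {1..n} \<Longrightarrow> A i \<subseteq> \<Omega> \<and> recursive (A i)"
  shows
    "(prob_space.indep_events (measure_pmf P) A {1..n} \<longleftrightarrow>
        (\<forall>\<alpha>. ensemble \<Omega> P \<alpha> \<longrightarrow>
          independent_ensembles (map (\<lambda>i. {0, 1}) [1..<Suc n])
            (map (\<lambda>i. event_pmf P (A i)) [1..<Suc n])
            (map (\<lambda>i. event_stream (A i) \<alpha>) [1..<Suc n]))) \<and>
     (prob_space.indep_events (measure_pmf P) A {1..n} \<longleftrightarrow>
        (\<exists>\<alpha>. ensemble \<Omega> P \<alpha> \<and>
          independent_ensembles (map (\<lambda>i. {0, 1}) [1..<Suc n])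
            (map (\<lambda>i. event_pmf P (A i)) [1..<Suc n])
            (map (\<lambda>i. event_stream (A i) \<alpha>) [1..<Suc n])))"
proof -
  let ?indep = "prob_space.indep_events (measure_pmf P) A {1..n}"
  let ?alphabet = "listset (map (\<lambda>i. {0, 1 :: nat}) [1..<Suc n])"
  let ?Q = "product_pmf (map (\<lambda>i. event_pmf P (A i)) [1..<Suc n])"
  let ?R = "map_pmf (event_vector A n) P"
  have independent_iff: "independent_ensembles (map (\<lambda>i. {0, 1}) [1..<Suc n])
      (map (\<lambda>i. event_pmf P (A i)) [1..<Suc n]) (map (\<lambda>i. event_stream (A i) \<alpha>) [1..<Suc n]) \<longleftrightarrow>
      ensemble ?alphabet ?Q (smap (event_vector A n) \<alpha>)" for \<alpha>
  proof -
    have "product_stream (map (\<lambda>i. event_stream (A i) \<alpha>) [1..<Suc n]) = smap (event_vector A n) \<alpha>"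
      by (subst (2) stream_smap_nats)
        (simp add: product_stream_def event_stream_def event_vector_def to_stream_def o_def
          of_bool_def snth_smap[abs_def] del: upt_Suc)
    then show ?thesis by (simp only: independent_ensembles_def)
  qed
  have "computable (\<lambda>a. map (\<lambda>i. of_bool (a \<in> A i) :: nat) is)" if "set is \<subseteq> {1..n}" for "is"
    using that
  proof (induction "is")
    case Nil
    show ?case by (simp add: computable_const)
  next
    case (Cons i "is")
    then show ?case
      using assms(5)[of i] recursive_imp_decidable[of "A i"]
      by (simp add: computable_Cons decidable_def)
  qed
  from this[of "[1..<Suc n]"] have computable: "computable (event_vector A n)"
    unfolding event_vector_def[abs_def] by (simp add: atLeastLessThanSuc_atLeastAtMost del: upt_Suc)
  have alphabet_eq: "?alphabet = {l. set l \<subseteq> {0, 1} \<and> length l = n}"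
  proof -
    have "listset (map (\<lambda>i. {0, 1 :: nat}) is) = {l. set l \<subseteq> {0, 1} \<and> length l = length is}"
      for "is" :: "nat list"
      by (induction "is") (auto simp: set_Cons_def length_Suc_conv)
    then show ?thesis by (simp del: upt_Suc)
  qed
  have re: "recursively_enumerable ?alphabet"
    unfolding alphabet_eq by (intro recursively_enumerable_finite finite_lists_length_eq) simp
  have "event_vector A n ` \<Omega> \<subseteq> ?alphabet"
    unfolding alphabet_eq by (auto simp: event_vector_def)
  then have image: "ensemble ?alphabet ?R (smap (event_vector A n) \<alpha>)" if "ensemble \<Omega> P \<alpha>" for \<alpha>
    using ensemble_smap[OF assms(2) computable _ that] by blast
  have "ensemble ?alphabet ?Q (smap (event_vector A n) \<alpha>) \<longleftrightarrow> ?indep" if "ensemble \<Omega> P \<alpha>" for \<alpha>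
  proof
    assume ?indep
    with image[OF that] show "ensemble ?alphabet ?Q (smap (event_vector A n) \<alpha>)"
      by (simp only: indep_events_imp_product_pmf[OF assms(4)])
  next
    assume "ensemble ?alphabet ?Q (smap (event_vector A n) \<alpha>)"
    with ensemble_determines_pmf[OF re image[OF that]] have "?R = ?Q" by blast
    then show ?indep by (rule product_pmf_imp_indep_events)
  qed
  moreover obtain \<alpha> where "ensemble \<Omega> P \<alpha>"
    using ensemble_exists[OF assms(3)] by blast
  ultimately show ?thesis
    unfolding independent_iff by blast
qed

end
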